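(* Let $A$ be a finitely generated differential algebra and let $M$ be a finitely generated left $A[\partial]$-module. (a) The space $\mathcal G(A,M)\subset\mathrm{CEnd}(M)\oplus\mathrm{CDer}(A)$ of all pairs $(\phi,\sigma)$ satisfying $$\phi_\lambda(a(\partial)u)=\sigma_\lambda(a(x))\big(\big|_{x=\partial}u\big)+a(\lambda+x)\big(\big|_{x=\partial}\phi_\lambda(u)\big)\qquad(a(\partial)\in A[\partial],\ u\in M),$$ with the $A[\partial]$-action $a(\partial)(\phi,\sigma)=(a(\partial)\phi,a(\partial)\sigma)$, where $$(a(\partial)\phi)_\lambda(u)=\big(\big|_{x=\partial}a^*(\lambda)\big)\phi_{\lambda+x}(u),\qquad(a(\partial)\sigma)_\lambda(b)=\big(\big|_{x=\partial}a^*(\lambda)\big)\sigma_{\lambda+x}(b),$$ the $\lambda$-bracket $[(\phi,\sigma)_\lambda(\psi,\tau)]=\sum_{i\ge0}\frac{\lambda^i}{i!}(\phi_{(i)}\psi,\sigma_{(i)}\tau)$, where $$\sum_{i\ge0}(\phi_{(i)}\psi)_\mu(v)\tfrac{\lambda^i}{i!}=\phi_\lambda(\psi_{\mu-\lambda}(v))-\psi_{\mu-\lambda}(\phi_\lambda(v)),\qquad\sum_{i\ge0}(\sigma_{(i)}\tau)_\mu(a)\tfrac{\lambda^i}{i!}=\sigma_\lambda(\tau_{\mu-\lambda}(a))-\tau_{\mu-\lambda}(\sigma_\lambda(a)),$$ and the anchor map $\theta:\mathcal G(A,M)\to\mathrm{CDer}(A)$, $\theta(\phi,\sigma)=\sigma$,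 is a Lie conformal algebroid over $A$. (b) The anchor map $\theta:\mathcal G(A,M)\to\mathrm{CDer}(A)$ is a homomorphism of Lie conformal algebroids. (c) The diagonal map $\Delta:\mathrm{CDer}(A)\to\mathcal G(A,A)$, $\sigma\mapsto(\sigma,\sigma)$, is a homomorphism of Lie conformal algebroids. Moreover, for $M=A$, $\theta\circ\Delta$ is the identity of $\mathrm{CDer}(A)$.
   Context: Everything is over a field $\mathbb F$ of characteristic $0$. A differential algebra $A$ is a commutative associative unital algebra with a derivation $\partial$; $A[\partial]$ is the associative algebra of differential operators $a(\partial)=\sum_i a_i\partial^i$ (product = composition), with symbol $a(x)=\sum_ia_ix^i$ and adjoint symbol $a^*(\lambda)=\sum_i(-\lambda-\partial)^i(a_i)\in A[\lambda]$. "Finitely generated" for $A$ means finitely generated as a differential algebra. Substitution convention: in an expression containing a factor $\big(\big|_{x=\partial}f\big)$, expand the whole expression in powers of the commuting indeterminate $x$ and replace each $x^n$ by $\partial^n$ acting only on what is inside that parenthesis (on coefficients, if $f$ is a polynomial). E.g. $a(\lambda+x)\big(\big|_{x=\partial}b\big)c=c\sum_ia_i(\lambda+\partial)^i(b)$. For $\sigma_\lambda$ linear, $\sigma_\lambda(a(x))=\sum_i\sigma_\lambda(a_i)x^i$. $\mathrm{CEnd}(M)$ is the space of linear maps $\phi_\lambda:M\to M[\lambda]$ with $\phi_\lambda(\partial u)=(\partial+\lambda)\phi_\lambda(u)$. $\mathrm{CDer}(A)$ is the space of linear maps $\phi_\lambda:A\to A[\lambda]$ with $\phi_\lambda(\partial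 a)=(\partial+\lambda)\phi_\lambda(a)$ and $\phi_\lambda(ab)=\phi_\lambda(a)b+a\phi_\lambda(b)$; it is a left $A[\partial]$-module by $(a(\partial)\phi)_\lambda=\big(\big|_{x=\partial}a^*(\lambda)\big)\phi_{\lambda+x}$. A Lie conformal algebra (LCA) is an $\mathbb F[\partial]$-module $E$ with a bilinear $\lambda$-bracket $[\cdot_\lambda\cdot]:E\otimes E\to E[\lambda]$ with: $[\partial u_\lambda v]=-\lambda[u_\lambda v]$, $[u_\lambda\partial v]=(\partial+\lambda)[u_\lambda v]$; $[v_\lambda u]=-\big(\big|_{x=\partial}[u_{-\lambda-x}v]\big)$; $[u_\lambda[v_\mu w]]-[v_\mu[u_\lambda w]]=[[u_\lambda v]_{\lambda+\mu}w]$. A Lie conformal algebroid (LCAd) over $A$ is a left $A[\partial]$-module $E$ with a left $A[\partial]$-module homomorphism $\theta:E\to\mathrm{CDer}(A)$ (anchor) and an LCA $\lambda$-bracket such that (i) $[u_\lambda a(\partial)v]=a(\lambda+x)\big(\big|_{x=\partial}[u_\lambda v]\big)+\theta(u)_\lambda(a(x))\big(\big|_{x=\partial}v\big)$, and (ii) $\theta([u_\lambda v])_\mu(a)=\theta(u)_\lambda(\theta(v)_{\mu-\lambda}(a))-\theta(v)_{\mu-\lambda}(\theta(u)_\lambda(a))$. A homomorphism of LCAd over $A$ is a linear map commuting with the $A[\partial]$-actions, the $\lambda$-brackets and the anchor maps (i.e. $\theta_F(\varphi(u))=\theta_E(u)$ for $\varphi:E\to F$). For $A$ finitely generated, $\mathrm{CDer}(A)$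 is an LCAd over $A$ with $\lambda$-bracket $[\phi_\lambda\psi]_\mu(a)=\phi_\lambda(\psi_{\mu-\lambda}(a))-\psi_{\mu-\lambda}(\phi_\lambda(a))$ and anchor the identity. *)

theory Defs
  imports
    "HOL-Computational_Algebra.Polynomial"
    "HOL-Library.Function_Algebras"
    "HOL-Library.Product_Plus"
begin

text \<open>
  For an abelian group \<open>V\<close>, the type \<open>'v poly\<close> serves as \<open>V[\<lambda>]\<close>, and \<open>'v poly poly\<close> as
  \<open>V[\<lambda>,\<mu>]\<close>, where the outer variable is \<open>\<lambda>\<close> and the inner one is \<open>\<mu>\<close>.  Spaces of functions such
  as \<open>CDer(A)\<close> are subsets of a function type, with the pointwise addition of Function\_Algebras;
  direct sums are products with the componentwise addition of Product\_Plus.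

  The sort \<open>{comm_ring, comm_monoid_mult}\<close> describes commutative unital rings, the zero ring
  included (which \<open>comm_ring_1\<close> would exclude).
\<close>

section \<open>Substitutions in polynomials\<close>

text \<open>Replace each monomial \<open>v x\<^sup>i\<close> of a polynomial by \<open>g i v\<close>.\<close>

definition poly_expand :: "(nat \<Rightarrow> 'v::zero \<Rightarrow> 'w::comm_monoid_add) \<Rightarrow> 'v poly \<Rightarrow> 'w" where
  "poly_expand g p = (\<Sum>i\<le>degree p. g i (coeff p i))"

text \<open>The operator \<open>\<lambda> + \<partial>\<close> on \<open>V[\<lambda>]\<close>, where \<open>\<partial>\<close> acts on coefficients by \<open>D\<close>.\<close>

definition lam_plus :: "('v \<Rightarrow> 'v) \<Rightarrow> 'v::ab_group_add poly \<Rightarrow> 'v poly" where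
  "lam_plus D p = pCons 0 p + map_poly D p"

text \<open>\<open>\<Sum>\<^sub>i (-\<lambda>-\<partial>)\<^sup>i (p\<^sub>i)\<close>.  For \<open>V = A\<close> this is the adjoint symbol \<open>p\<^sup>*(\<lambda>)\<close>; for a
  \<open>\<lambda>\<close>-bracket \<open>p(\<lambda>) = [u\<^sub>\<lambda> v]\<close> it is \<open>[u\<^bsub>-\<lambda>-x\<^esub> v]\<close> with \<open>x = \<partial>\<close> acting on the
  coefficients.\<close>

definition adj_subst :: "('v \<Rightarrow> 'v) \<Rightarrow> 'v::ab_group_add poly \<Rightarrow> 'v poly" where
  "adj_subst D p = poly_expand (\<lambda>i c. ((\<lambda>q. - lam_plus D q) ^^ i) [:c:]) p"

text \<open>Multiplication by \<open>\<lambda>\<close> and by \<open>\<mu>\<close> on \<open>V[\<lambda>,\<mu>]\<close>, and the inclusion of \<open>V[\<lambda>]\<close>.\<close>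

definition mult_lam :: "'v::ab_group_add poly poly \<Rightarrow> 'v poly poly" where
  "mult_lam q = pCons 0 q"

definition mult_mu :: "'v::ab_group_add poly poly \<Rightarrow> 'v poly poly" where
  "mult_mu q = map_poly (pCons 0) q"

definition embed_lam :: "'v::ab_group_add poly \<Rightarrow> 'v poly poly" where
  "embed_lam p = map_poly (\<lambda>c. [:c:]) p"

text \<open>\<open>p(\<lambda>+\<mu>)\<close> and \<open>p(\<mu>-\<lambda>)\<close>\<close>

definition at_lam_plus_mu :: "'v::ab_group_add poly \<Rightarrow> 'v poly poly" where
  "at_lam_plus_mu p = poly_expand (\<lambda>n c. ((\<lambda>q. mult_lam q + mult_mu q) ^^ n) [:[:c:]:]) p"

definition at_mu_minus_lam :: "'v::ab_group_add poly \<Rightarrow> 'v poly poly" where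
  "at_mu_minus_lam p = poly_expand (\<lambda>n c. ((\<lambda>q. mult_mu q - mult_lam q) ^^ n) [:[:c:]:]) p"

section \<open>Differential algebras and their modules\<close>

locale differential_algebra = vector_space scale
  for scale :: "'k::field_char_0 \<Rightarrow> 'a::{comm_ring,comm_monoid_mult} \<Rightarrow> 'a" +
  fixes d :: "'a \<Rightarrow> 'a"
  assumes scale_mult: "scale c (a * b) = scale c a * b"
    and d_add: "d (a + b) = d a + d b"
    and d_scale: "d (scale c a) = scale c (d a)"
    and d_mult: "d (a * b) = d a * b + a * d b"

inductive_set dalg_generated ::
  "('k \<Rightarrow> 'a \<Rightarrow> 'a) \<Rightarrow> ('a \<Rightarrow> 'a) \<Rightarrow> 'a set \<Rightarrow> 'a::{comm_ring,comm_monoid_mult} set"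
  for scale :: "'k \<Rightarrow> 'a \<Rightarrow> 'a" and d :: "'a \<Rightarrow> 'a" and S :: "'a set" where
  gen: "a \<in> S \<Longrightarrow> a \<in> dalg_generated scale d S"
| one: "1 \<in> dalg_generated scale d S"
| scale: "a \<in> dalg_generated scale d S \<Longrightarrow> scale c a \<in> dalg_generated scale d S"
| add: "a \<in> dalg_generated scale d S \<Longrightarrow> b \<in> dalg_generated scale d S \<Longrightarrow>
    a + b \<in> dalg_generated scale d S"
| mult: "a \<in> dalg_generated scale d S \<Longrightarrow> b \<in> dalg_generated scale d S \<Longrightarrow>
    a * b \<in> dalg_generated scale d S"
| deriv: "a \<in> dalg_generated scale d S \<Longrightarrow> d a \<in> dalg_generated scale d S"

definition fg_differential_algebra ::
  "('k::field_char_0 \<Rightarrow> 'a::{comm_ring,comm_monoid_mult} \<Rightarrow> 'a) \<Rightarrow> ('a \<Rightarrow> 'a) \<Rightarrow> bool" where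
  "fg_differential_algebra scale d \<longleftrightarrow>
    differential_algebra scale d \<and> (\<exists>S. finite S \<and> dalg_generated scale d S = UNIV)"

text \<open>An element \<open>\<Sum>\<^sub>i a\<^sub>i \<partial>\<^sup>i\<close> of \<open>A[\<partial>]\<close> is represented by its symbol \<open>\<Sum>\<^sub>i a\<^sub>i x\<^sup>i\<close>.  The
  composition of \<open>a(\<partial>)\<close> and \<open>b(\<partial>)\<close> has symbol \<open>\<Sum>\<^sub>i a\<^sub>i (x+\<partial>)\<^sup>i (b(x))\<close>, because
  \<open>\<partial> b = b \<partial> + \<partial>(b)\<close> for \<open>b\<close> in \<open>A\<close>.\<close>

definition dop_mult ::
  "('a \<Rightarrow> 'a) \<Rightarrow> 'a::{comm_ring,comm_monoid_mult} poly \<Rightarrow> 'a poly \<Rightarrow> 'a poly" where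
  "dop_mult d a b = poly_expand (\<lambda>i c. smult c ((lam_plus d ^^ i) b)) a"

text \<open>A left \<open>A[\<partial>]\<close>-module carried by a subgroup \<open>E\<close> of \<open>'e\<close>\<close>

locale dop_module =
  fixes d :: "'a \<Rightarrow> 'a::{comm_ring,comm_monoid_mult}"
    and E :: "'e::ab_group_add set"
    and act :: "'a poly \<Rightarrow> 'e \<Rightarrow> 'e"
  assumes zero_closed: "0 \<in> E"
    and add_closed: "u \<in> E \<Longrightarrow> v \<in> E \<Longrightarrow> u + v \<in> E"
    and uminus_closed: "u \<in> E \<Longrightarrow> - u \<in> E"
    and act_closed: "u \<in> E \<Longrightarrow> act a u \<in> E"
    and act_add_right: "u \<in> E \<Longrightarrow> v \<in> E \<Longrightarrow> act a (u + v) = act a u + act a v"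
    and act_add_left: "u \<in> E \<Longrightarrow> act (a + b) u = act a u + act b u"
    and act_mult: "u \<in> E \<Longrightarrow> act (dop_mult d a b) u = act a (act b u)"
    and act_one: "u \<in> E \<Longrightarrow> act [:1:] u = u"

definition fg_dop_module ::
  "('a \<Rightarrow> 'a::{comm_ring,comm_monoid_mult}) \<Rightarrow> 'e::ab_group_add set \<Rightarrow> ('a poly \<Rightarrow> 'e \<Rightarrow> 'e) \<Rightarrow> bool"
  where
  "fg_dop_module d E act \<longleftrightarrow> dop_module d E act \<and>
    (\<exists>S. finite S \<and> S \<subseteq> E \<and> (\<forall>u\<in>E. \<exists>a. u = (\<Sum>s\<in>S. act (a s) s)))"

text \<open>The actions of \<open>\<partial>\<close>, of \<open>A\<close> and of the base field on a left \<open>A[\<partial>]\<close>-module\<close>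

definition del_act :: "('a::{comm_ring,comm_monoid_mult} poly \<Rightarrow> 'e \<Rightarrow> 'e) \<Rightarrow> 'e \<Rightarrow> 'e" where
  "del_act act u = act [:0, 1:] u"

definition alg_act :: "('a::{comm_ring,comm_monoid_mult} poly \<Rightarrow> 'e \<Rightarrow> 'e) \<Rightarrow> 'a \<Rightarrow> 'e \<Rightarrow> 'e" where
  "alg_act act b u = act [:b:] u"

definition scalar_act ::
  "('k \<Rightarrow> 'a::{comm_ring,comm_monoid_mult} \<Rightarrow> 'a) \<Rightarrow> ('a poly \<Rightarrow> 'e \<Rightarrow> 'e) \<Rightarrow> 'k \<Rightarrow> 'e \<Rightarrow> 'e" where
  "scalar_act scale act c u = alg_act act (scale c 1) u"

definition regular_act ::
  "('a \<Rightarrow> 'a) \<Rightarrow> 'a::{comm_ring,comm_monoid_mult} poly \<Rightarrow> 'a \<Rightarrow> 'a" where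
  "regular_act d a b = poly_expand (\<lambda>i c. c * (d ^^ i) b) a"

text \<open>\<open>a(\<lambda>+x)\<close> with \<open>x = \<partial>\<close> acting on the coefficients of \<open>p\<close>:
  \<open>\<Sum>\<^sub>i a\<^sub>i (\<lambda>+\<partial>)\<^sup>i p\<close>\<close>

definition shifted_act ::
  "('a::{comm_ring,comm_monoid_mult} poly \<Rightarrow> 'e::ab_group_add \<Rightarrow> 'e) \<Rightarrow> 'a poly \<Rightarrow> 'e poly \<Rightarrow> 'e poly"
  where
  "shifted_act act a p =
    poly_expand (\<lambda>i b. map_poly (alg_act act b) ((lam_plus (del_act act) ^^ i) p)) a"

text \<open>\<open>\<sigma>\<^sub>\<lambda>(a(x))\<close> with \<open>x = \<partial>\<close> acting on \<open>u\<close>: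
  \<open>\<Sum>\<^sub>i \<sigma>\<^sub>\<lambda>(a\<^sub>i) \<partial>\<^sup>i u\<close>\<close>

definition symbol_act ::
  "('a::{comm_ring,comm_monoid_mult} poly \<Rightarrow> 'e::ab_group_add \<Rightarrow> 'e) \<Rightarrow> ('a \<Rightarrow> 'a poly) \<Rightarrow>
    'a poly \<Rightarrow> 'e \<Rightarrow> 'e poly"
  where
  "symbol_act act \<sigma> a u =
    poly_expand (\<lambda>i b. map_poly (\<lambda>c. alg_act act c ((del_act act ^^ i) u)) (\<sigma> b)) a"

section \<open>Conformal endomorphisms and derivations\<close>

definition CEnd ::
  "('k \<Rightarrow> 'm \<Rightarrow> 'm) \<Rightarrow> ('m \<Rightarrow> 'm) \<Rightarrow> ('m \<Rightarrow> 'm::ab_group_add poly) set" where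
  "CEnd s D = {\<phi>.
    (\<forall>u v. \<phi> (u + v) = \<phi> u + \<phi> v) \<and>
    (\<forall>c u. \<phi> (s c u) = map_poly (s c) (\<phi> u)) \<and>
    (\<forall>u. \<phi> (D u) = lam_plus D (\<phi> u))}"

definition CDer ::
  "('k \<Rightarrow> 'a \<Rightarrow> 'a) \<Rightarrow> ('a \<Rightarrow> 'a) \<Rightarrow> ('a \<Rightarrow> 'a::{comm_ring,comm_monoid_mult} poly) set" where
  "CDer scale d = {\<phi> \<in> CEnd scale d. \<forall>a b. \<phi> (a * b) = smult b (\<phi> a) + smult a (\<phi> b)}"

text \<open>\<open>(a(\<partial>)\<phi>)\<^sub>\<lambda>(u) = \<Sum>\<^sub>i (\<lambda>+\<partial>)\<^sup>i(a\<^sup>*(\<lambda>)) \<phi>\<^sub>i(u)\<close>, where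
  \<open>\<phi>\<^sub>\<lambda>(u) = \<Sum>\<^sub>i \<phi>\<^sub>i(u) \<lambda>\<^sup>i\<close> and \<open>\<partial>\<close> acts on the coefficients of \<open>a\<^sup>*(\<lambda>)\<close>\<close>

definition conf_act ::
  "('a \<Rightarrow> 'a) \<Rightarrow> ('a::{comm_ring,comm_monoid_mult} poly \<Rightarrow> 'm::ab_group_add \<Rightarrow> 'm) \<Rightarrow>
    'a poly \<Rightarrow> ('m \<Rightarrow> 'm poly) \<Rightarrow> 'm \<Rightarrow> 'm poly"
  where
  "conf_act d act a \<phi> u =
    poly_expand (\<lambda>i w. map_poly (\<lambda>b. alg_act act b w) ((lam_plus d ^^ i) (adj_subst d a))) (\<phi> u)"

text \<open>\<open>\<phi>\<^sub>\<lambda>(\<psi>\<^bsub>\<mu>-\<lambda>\<^esub>(v)) - \<psi>\<^bsub>\<mu>-\<lambda>\<^esub>(\<phi>\<^sub>\<lambda>(v))\<close>\<close>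

definition conf_commutator ::
  "('m \<Rightarrow> 'm::ab_group_add poly) \<Rightarrow> ('m \<Rightarrow> 'm poly) \<Rightarrow> 'm \<Rightarrow> 'm poly poly" where
  "conf_commutator \<phi> \<psi> v =
    poly_expand (\<lambda>j c. ((\<lambda>q. mult_mu q - mult_lam q) ^^ j) (embed_lam (\<phi> c))) (\<psi> v)
    - poly_expand (\<lambda>i c. (mult_lam ^^ i) (at_mu_minus_lam (\<psi> c))) (\<phi> v)"

text \<open>The product \<open>\<phi>\<^sub>(\<^sub>i\<^sub>)\<psi>\<close>, for the scalar multiplication \<open>s\<close> of the base field\<close>

definition conf_nprod ::
  "('k::field_char_0 \<Rightarrow> 'm \<Rightarrow> 'm) \<Rightarrow> nat \<Rightarrow>
    ('m \<Rightarrow> 'm::ab_group_add poly) \<Rightarrow> ('m \<Rightarrow> 'm poly) \<Rightarrow> 'm \<Rightarrow> 'm poly"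
  where
  "conf_nprod s i \<phi> \<psi> v = map_poly (s (fact i)) (coeff (conf_commutator \<phi> \<psi> v) i)"

section \<open>Lie conformal algebras and algebroids\<close>

text \<open>The base field with the zero derivation is a differential algebra whose differential
  operators are the polynomials in \<open>\<partial>\<close>.\<close>

locale lie_conformal_algebra = dop_module "\<lambda>_. 0" E kact
  for E :: "'e::ab_group_add set" and kact :: "'k::field_char_0 poly \<Rightarrow> 'e \<Rightarrow> 'e" +
  fixes br :: "'e \<Rightarrow> 'e \<Rightarrow> 'e poly"
  assumes br_closed: "u \<in> E \<Longrightarrow> v \<in> E \<Longrightarrow> coeff (br u v) n \<in> E"
    and br_add_left: "u \<in> E \<Longrightarrow> v \<in> E \<Longrightarrow> w \<in> E \<Longrightarrow> br (u + v) w = br u w + br v w"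
    and br_add_right: "u \<in> E \<Longrightarrow> v \<in> E \<Longrightarrow> w \<in> E \<Longrightarrow> br u (v + w) = br u v + br u w"
    and br_scale_left: "u \<in> E \<Longrightarrow> v \<in> E \<Longrightarrow>
      br (alg_act kact c u) v = map_poly (alg_act kact c) (br u v)"
    and br_scale_right: "u \<in> E \<Longrightarrow> v \<in> E \<Longrightarrow>
      br u (alg_act kact c v) = map_poly (alg_act kact c) (br u v)"
    and br_del_left: "u \<in> E \<Longrightarrow> v \<in> E \<Longrightarrow> br (del_act kact u) v = - pCons 0 (br u v)"
    and br_del_right: "u \<in> E \<Longrightarrow> v \<in> E \<Longrightarrow>
      br u (del_act kact v) = lam_plus (del_act kact) (br u v)"
    and skew_symmetry: "u \<in> E \<Longrightarrow> v \<in> E \<Longrightarrow>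
      br v u = - adj_subst (del_act kact) (br u v)"
    and jacobi: "u \<in> E \<Longrightarrow> v \<in> E \<Longrightarrow> w \<in> E \<Longrightarrow>
      poly_expand (\<lambda>j c. (mult_mu ^^ j) (embed_lam (br u c))) (br v w)
      - map_poly (br v) (br u w)
      = poly_expand (\<lambda>k z. (mult_lam ^^ k) (at_lam_plus_mu (br z w))) (br u v)"

locale lie_conformal_algebroid =
  differential_algebra scale d +
  dop_module d E act +
  lie_conformal_algebra E "\<lambda>p. act (map_poly (\<lambda>c. scale c 1) p)" br
  for scale :: "'k::field_char_0 \<Rightarrow> 'a::{comm_ring,comm_monoid_mult} \<Rightarrow> 'a"
    and d :: "'a \<Rightarrow> 'a"
    and E :: "'e::ab_group_add set"
    and act :: "'a poly \<Rightarrow> 'e \<Rightarrow> 'e"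
    and br :: "'e \<Rightarrow> 'e \<Rightarrow> 'e poly" +
  fixes \<theta> :: "'e \<Rightarrow> 'a \<Rightarrow> 'a poly"
  assumes anchor_closed: "u \<in> E \<Longrightarrow> \<theta> u \<in> CDer scale d"
    and anchor_add: "u \<in> E \<Longrightarrow> v \<in> E \<Longrightarrow> \<theta> (u + v) = \<theta> u + \<theta> v"
    and anchor_act: "u \<in> E \<Longrightarrow> \<theta> (act a u) = conf_act d (regular_act d) a (\<theta> u)"
    and br_act: "u \<in> E \<Longrightarrow> v \<in> E \<Longrightarrow>
      br u (act a v) = shifted_act act a (br u v) + symbol_act act (\<theta> u) a v"
    and anchor_br: "u \<in> E \<Longrightarrow> v \<in> E \<Longrightarrow>
      map_poly (\<lambda>z. \<theta> z b) (br u v) = conf_commutator (\<theta> u) (\<theta> v) b"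

text \<open>Linearity over the base field follows from \<open>hom_add\<close> and \<open>hom_act\<close>.\<close>

locale lie_conformal_algebroid_hom =
  source: lie_conformal_algebroid scale d E act br \<theta> +
  target: lie_conformal_algebroid scale d E' act' br' \<theta>'
  for scale :: "'k::field_char_0 \<Rightarrow> 'a::{comm_ring,comm_monoid_mult} \<Rightarrow> 'a"
    and d :: "'a \<Rightarrow> 'a"
    and E :: "'e::ab_group_add set"
    and act :: "'a poly \<Rightarrow> 'e \<Rightarrow> 'e"
    and br :: "'e \<Rightarrow> 'e \<Rightarrow> 'e poly"
    and \<theta> :: "'e \<Rightarrow> 'a \<Rightarrow> 'a poly"
    and E' :: "'f::ab_group_add set"
    and act' :: "'a poly \<Rightarrow> 'f \<Rightarrow> 'f"
    and br' :: "'f \<Rightarrow> 'f \<Rightarrow> 'f poly"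
    and \<theta>' :: "'f \<Rightarrow> 'a \<Rightarrow> 'a poly" +
  fixes f :: "'e \<Rightarrow> 'f"
  assumes hom_closed: "u \<in> E \<Longrightarrow> f u \<in> E'"
    and hom_add: "u \<in> E \<Longrightarrow> v \<in> E \<Longrightarrow> f (u + v) = f u + f v"
    and hom_act: "u \<in> E \<Longrightarrow> f (act a u) = act' a (f u)"
    and hom_br: "u \<in> E \<Longrightarrow> v \<in> E \<Longrightarrow> br' (f u) (f v) = map_poly f (br u v)"
    and hom_anchor: "u \<in> E \<Longrightarrow> \<theta>' (f u) = \<theta> u"

section \<open>The algebroids \<open>CDer(A)\<close> and \<open>\<G>(A,M)\<close>\<close>

text \<open>\<open>Abs_poly\<close> is meaningful only for sequences of finite support.  For the bracket of
  \<open>CDer(A)\<close> this is contained in the axiom \<open>anchor_br\<close> with the identity as anchor.\<close>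

definition CDer_br ::
  "('a \<Rightarrow> 'a::{comm_ring,comm_monoid_mult} poly) \<Rightarrow> ('a \<Rightarrow> 'a poly) \<Rightarrow> ('a \<Rightarrow> 'a poly) poly" where
  "CDer_br \<phi> \<psi> = Abs_poly (\<lambda>i a. coeff (conf_commutator \<phi> \<psi> a) i)"

definition gauge ::
  "('k::field_char_0 \<Rightarrow> 'a::{comm_ring,comm_monoid_mult} \<Rightarrow> 'a) \<Rightarrow> ('a \<Rightarrow> 'a) \<Rightarrow>
    ('a poly \<Rightarrow> 'm::ab_group_add \<Rightarrow> 'm) \<Rightarrow> (('m \<Rightarrow> 'm poly) \<times> ('a \<Rightarrow> 'a poly)) set"
  where
  "gauge scale d act = {(\<phi>, \<sigma>).
    \<phi> \<in> CEnd (scalar_act scale act) (del_act act) \<and> \<sigma> \<in> CDer scale d \<and>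
    (\<forall>a u. \<phi> (act a u) = symbol_act act \<sigma> a u + shifted_act act a (\<phi> u))}"

definition gauge_act ::
  "('a \<Rightarrow> 'a) \<Rightarrow> ('a::{comm_ring,comm_monoid_mult} poly \<Rightarrow> 'm::ab_group_add \<Rightarrow> 'm) \<Rightarrow> 'a poly \<Rightarrow>
    ('m \<Rightarrow> 'm poly) \<times> ('a \<Rightarrow> 'a poly) \<Rightarrow> ('m \<Rightarrow> 'm poly) \<times> ('a \<Rightarrow> 'a poly)"
  where
  "gauge_act d act a = (\<lambda>(\<phi>, \<sigma>). (conf_act d act a \<phi>, conf_act d (regular_act d) a \<sigma>))"

definition gauge_scale ::
  "('k::field_char_0 \<Rightarrow> 'a::{comm_ring,comm_monoid_mult} \<Rightarrow> 'a) \<Rightarrow>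
    ('a poly \<Rightarrow> 'm::ab_group_add \<Rightarrow> 'm) \<Rightarrow> 'k \<Rightarrow>
    ('m \<Rightarrow> 'm poly) \<times> ('a \<Rightarrow> 'a poly) \<Rightarrow> ('m \<Rightarrow> 'm poly) \<times> ('a \<Rightarrow> 'a poly)"
  where
  "gauge_scale scale act c = (\<lambda>(\<phi>, \<sigma>).
    (\<lambda>u. map_poly (scalar_act scale act c) (\<phi> u), \<lambda>a. map_poly (scale c) (\<sigma> a)))"

definition gauge_nprod ::
  "('k::field_char_0 \<Rightarrow> 'a::{comm_ring,comm_monoid_mult} \<Rightarrow> 'a) \<Rightarrow>
    ('a poly \<Rightarrow> 'm::ab_group_add \<Rightarrow> 'm) \<Rightarrow> nat \<Rightarrow>
    ('m \<Rightarrow> 'm poly) \<times> ('a \<Rightarrow> 'a poly) \<Rightarrow> ('m \<Rightarrow> 'm poly) \<times> ('a \<Rightarrow> 'a poly) \<Rightarrow>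
    ('m \<Rightarrow> 'm poly) \<times> ('a \<Rightarrow> 'a poly)"
  where
  "gauge_nprod scale act i = (\<lambda>(\<phi>, \<sigma>) (\<psi>, \<tau>).
    (conf_nprod (scalar_act scale act) i \<phi> \<psi>, conf_nprod scale i \<sigma> \<tau>))"

definition gauge_br ::
  "('k::field_char_0 \<Rightarrow> 'a::{comm_ring,comm_monoid_mult} \<Rightarrow> 'a) \<Rightarrow>
    ('a poly \<Rightarrow> 'm::ab_group_add \<Rightarrow> 'm) \<Rightarrow>
    ('m \<Rightarrow> 'm poly) \<times> ('a \<Rightarrow> 'a poly) \<Rightarrow> ('m \<Rightarrow> 'm poly) \<times> ('a \<Rightarrow> 'a poly) \<Rightarrow>
    (('m \<Rightarrow> 'm poly) \<times> ('a \<Rightarrow> 'a poly)) poly"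
  where
  "gauge_br scale act X Y =
    Abs_poly (\<lambda>i. gauge_scale scale act (inverse (fact i)) (gauge_nprod scale act i X Y))"

definition gauge_anchor ::
  "('m \<Rightarrow> 'm poly) \<times> ('a \<Rightarrow> 'a poly) \<Rightarrow> 'a::{comm_ring,comm_monoid_mult} \<Rightarrow> 'a poly" where
  "gauge_anchor = snd"

definition diagonal :: "('a \<Rightarrow> 'a poly) \<Rightarrow>
    ('a \<Rightarrow> 'a::{comm_ring,comm_monoid_mult} poly) \<times> ('a \<Rightarrow> 'a poly)" where
  "diagonal \<sigma> = (\<sigma>, \<sigma>)"

end

(*
  A polynomial over a vector space of characteristic 0 is determined by its values at scalars.
  After evaluation a conformal endomorphism phi becomes a family of honest linear operators phi_t,
  and the lambda-bracket becomes [X_s Y]_t = [X_s, Y_(t-s)], an ordinary commutator: skew symmetry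
  and the Jacobi identity are those of operators.  The action of a in A is
  (a phi)_t(u) = sum_i (t + D)^i(a) phi_i(u) with D the derivation of A, so it depends on the whole
  polynomial phi(u); the identities involving it follow from the substitution of t + D for the
  variable being compatible with products, shifts and Leibniz rules.  Finite generation is needed
  only to bound the degree in lambda of the commutators, which does not grow under the derivation
  and under products.
*)

theory Submission
  imports Defs
begin

section \<open>Coefficientwise operations on polynomials\<close>

text \<open>\<open>A\<close> and \<partial> generate A[\<partial>], and \<partial> acts on conformal
  maps as multiplication by -\<lambda>, so the real work is the action of a in \<open>A\<close>. The
  obstacle is that (aY) at t is not a function of the operator of Y at t. In [X_l (aY)] at m, the
  operator of aY is taken at m-l and substitutes m-l+\<partial> into the polynomial Y(v); in
  a[X_l Y] at m, m+\<partial> is substituted into the polynomial [X_l Y](v). These match because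
  [X_l Y](v), as a polynomial in t, is a commutator with Y at t-l, hence a polynomial with its
  variable shifted by l. The remaining term, with anchor(X)_l(a), appears where X_l hits a: since
  \<sigma>_l \<partial> = (\<partial>+l) \<sigma>_l, it turns m-l+\<partial> into m+\<partial>. The
  algebroid axioms are proved once, for elements determined by a representation on \<open>M\<close>
  and an anchor on \<open>A\<close>. The anchor is a representation of the same kind with M = A, so
  every identity is an operator identity checked on \<open>M\<close> and on \<open>A\<close>.
  CDer(A) is the case where M = A and both maps are the identity.\<close>

lemma additive_map_poly: "additive f \<Longrightarrow> additive (map_poly f)"
  using additive.zero[of f] by (simp add: additive_def coeff_map_poly poly_eq_iff)

lemma additive_lam_plus: "additive D \<Longrightarrow> additive (lam_plus D)"
  using additive.add[OF additive_map_poly, of D] by (simp add: additive_def lam_plus_def)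

lemma additive_funpow: "additive (f :: 'v::ab_group_add \<Rightarrow> 'v) \<Longrightarrow> additive (f ^^ n)"
  by (induction n) (auto simp: additive_def)

lemma additive_add: "additive f \<Longrightarrow> additive g \<Longrightarrow> additive (\<lambda>v. f v + g v)"
  by (simp add: additive_def algebra_simps)

lemma additive_const_poly: "additive (\<lambda>c. [:c:])"
  by (simp add: additive_def)

lemma additive_pCons_0: "additive (pCons 0)"
  by (simp add: additive_def)

lemma funpow_intertwine: "(\<And>v. h (F v) = G (h v)) \<Longrightarrow> h ((F ^^ n) v) = (G ^^ n) (h v)"
  by (induction n) simp_all

lemma poly_expand_bound:
  assumes "\<And>i. g i 0 = 0" "degree p \<le> n"
  shows "poly_expand g p = (\<Sum>i\<le>n. g i (coeff p i))"
  unfolding poly_expand_def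
  by (rule sum.mono_neutral_left) (use assms in \<open>auto simp: coeff_eq_0\<close>)

lemma poly_expand_0: "g 0 0 = 0 \<Longrightarrow> poly_expand g 0 = 0"
  by (simp add: poly_expand_def)

lemma poly_expand_pCons:
  assumes "\<And>i. g i 0 = 0"
  shows "poly_expand g (pCons c p) = g 0 c + poly_expand (\<lambda>i. g (Suc i)) p"
proof -
  have "poly_expand g (pCons c p) = (\<Sum>i\<le>Suc (degree p). g i (coeff (pCons c p) i))"
    by (rule poly_expand_bound) (simp_all add: assms degree_pCons_le)
  also have "\<dots> = g 0 c + (\<Sum>i\<le>degree p. g (Suc i) (coeff p i))"
    by (simp add: sum.atMost_Suc_shift del: sum.atMost_Suc)
  finally show ?thesis by (simp add: poly_expand_def)
qed

lemma poly_expand_const: "(\<And>i. g i 0 = 0) \<Longrightarrow> poly_expand g [:c:] = g 0 c"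
  by (simp add: poly_expand_def)

lemma poly_expand_cong:
  "(\<And>i. g i (coeff p i) = h i (coeff p i)) \<Longrightarrow> poly_expand g p = poly_expand h p"
  by (simp add: poly_expand_def)

lemma poly_expand_additive:
  fixes g :: "nat \<Rightarrow> 'u::zero \<Rightarrow> 'v::ab_group_add"
  shows "additive h \<Longrightarrow> h (poly_expand g p) = poly_expand (\<lambda>i c. h (g i c)) p"
  by (simp add: poly_expand_def additive.sum)

lemma additive_poly_expand:
  fixes g :: "nat \<Rightarrow> 'v::ab_group_add \<Rightarrow> 'w::ab_group_add"
  assumes "\<And>i. additive (g i)"
  shows "additive (poly_expand g)"
proof
  fix p q :: "'v poly"
  let ?n = "max (degree p) (degree q)"
  have z: "g i 0 = 0" for i using additive.zero[OF assms] .
  have "poly_expand g (p + q) = (\<Sum>i\<le>?n. g i (coeff (p + q) i))"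
    by (rule poly_expand_bound) (simp_all add: z degree_add_le_max)
  also have "\<dots> = poly_expand g p + poly_expand g q"
    by (simp add: poly_expand_bound[of g _ ?n, OF z] additive.add[OF assms] sum.distrib)
  finally show "poly_expand g (p + q) = poly_expand g p + poly_expand g q" .
qed

lemma poly_expand_map_poly:
  assumes "f 0 = 0" "\<And>i. g i 0 = 0"
  shows "poly_expand g (map_poly f p) = poly_expand (\<lambda>i c. g i (f c)) p"
proof -
  have "degree (map_poly f p) \<le> degree p"
    by (rule degree_le) (simp add: coeff_map_poly[of f, OF assms(1)] coeff_eq_0 assms)
  then show ?thesis
    by (subst poly_expand_bound[of g _ "degree p"])
      (simp_all add: assms coeff_map_poly poly_expand_def)
qed

lemma degree_map_poly_le: "f 0 = 0 \<Longrightarrow> degree (map_poly f p) \<le> degree p"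
  by (rule degree_le) (simp add: coeff_map_poly coeff_eq_0)

section \<open>Evaluation of polynomials at scalars\<close>

definition poly_eval :: "('k::field \<Rightarrow> 'v \<Rightarrow> 'v) \<Rightarrow> 'k \<Rightarrow> 'v::ab_group_add poly \<Rightarrow> 'v" where
  "poly_eval s t p = poly_expand (\<lambda>i c. s (t ^ i) c) p"

lemma vector_space_poly:
  assumes "vector_space s"
  shows "vector_space (\<lambda>c. map_poly (s c))"
proof -
  interpret vector_space s by fact
  show ?thesis
    by unfold_locales (simp_all add: poly_eq_iff coeff_map_poly algebra_simps)
qed

context vector_space
begin

lemma additive_scale: "additive (scale c)"
  by unfold_locales (simp add: scale_right_distrib)

lemma funpow_scale: "(scale c ^^ n) v = scale (c ^ n) v"
  by (induction n) simp_all

lemma additive_poly_eval: "additive (poly_eval scale t)"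
  unfolding poly_eval_def by (intro additive_poly_expand additive_scale)

lemma poly_eval_0 [simp]: "poly_eval scale t 0 = 0"
  by (rule additive.zero[OF additive_poly_eval])

lemma poly_eval_add: "poly_eval scale t (p + q) = poly_eval scale t p + poly_eval scale t q"
  by (rule additive.add[OF additive_poly_eval])

lemma poly_eval_diff: "poly_eval scale t (p - q) = poly_eval scale t p - poly_eval scale t q"
  by (rule additive.diff[OF additive_poly_eval])

lemma poly_eval_minus: "poly_eval scale t (- p) = - poly_eval scale t p"
  by (rule additive.minus[OF additive_poly_eval])

lemma poly_eval_const [simp]: "poly_eval scale t [:c:] = c"
  by (simp add: poly_eval_def poly_expand_const)

lemma poly_eval_poly_expand:
  "poly_eval scale t (poly_expand g p) = poly_expand (\<lambda>i c. poly_eval scale t (g i c)) p"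
  by (rule poly_expand_additive[OF additive_poly_eval])

lemma poly_eval_pCons:
  "poly_eval scale t (pCons c p) = c + scale t (poly_eval scale t p)"
proof -
  have "poly_eval scale t (pCons c p) = c + poly_expand (\<lambda>i c. scale (t ^ Suc i) c) p"
    by (simp add: poly_eval_def poly_expand_pCons)
  also have "poly_expand (\<lambda>i c. scale (t ^ Suc i) c) p = scale t (poly_eval scale t p)"
    by (simp add: poly_eval_def poly_expand_additive[OF additive_scale])
  finally show ?thesis .
qed

lemma additive_on_sum:
  assumes "subspace E" "\<And>u v. u \<in> E \<Longrightarrow> v \<in> E \<Longrightarrow> f (u + v) = f u + (f v :: 'w::ab_group_add)"
    "\<And>i. i \<in> I \<Longrightarrow> g i \<in> E"
  shows "f (sum g I) = (\<Sum>i\<in>I. f (g i))"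
proof -
  have 0: "f 0 = 0"
    using assms(2)[of 0 0] subspace_0[OF assms(1)] by simp
  show ?thesis
    using assms(3)
    by (induction I rule: infinite_finite_induct)
      (simp_all add: 0 assms(2) subspace_sum[OF assms(1)])
qed

lemma poly_eval_linear_on:
  assumes "subspace E"
    "\<And>u v. u \<in> E \<Longrightarrow> v \<in> E \<Longrightarrow> f (u + v) = f u + (f v :: 'w::ab_group_add)"
    "\<And>c u. u \<in> E \<Longrightarrow> f (scale c u) = s' c (f u)"
    "\<And>i. coeff p i \<in> E"
  shows "f (poly_eval scale t p) = poly_expand (\<lambda>i c. s' (t ^ i) (f c)) p"
  unfolding poly_eval_def poly_expand_def
  by (subst additive_on_sum[of E f]) (simp_all add: assms subspace_scale)

lemma poly_eval_map_poly_on: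
  assumes "vector_space s'" "subspace E"
    "\<And>u v. u \<in> E \<Longrightarrow> v \<in> E \<Longrightarrow> f (u + v) = f u + (f v :: 'w::ab_group_add)"
    "\<And>c u. u \<in> E \<Longrightarrow> f (scale c u) = s' c (f u)"
    "\<And>i. coeff p i \<in> E"
  shows "poly_eval s' t (map_poly f p) = f (poly_eval scale t p)"
proof -
  interpret V: vector_space s' by fact
  have 0: "f 0 = 0"
    using assms(3)[of 0 0] subspace_0[OF assms(2)] by simp
  show ?thesis
    by (subst poly_eval_linear_on[of E f s', OF assms(2-5)])
      (auto simp: poly_eval_def poly_expand_map_poly 0)
qed

lemma poly_eval_linear:
  assumes "additive f" "\<And>c u. f (scale c u) = s' c (f u)"
  shows "f (poly_eval scale t p) = poly_expand (\<lambda>i c. s' (t ^ i) (f c)) p"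
  by (rule poly_eval_linear_on[where E = UNIV]) (simp_all add: assms additive.add[OF assms(1)])

lemma poly_eval_map_poly:
  assumes "vector_space s'" "additive f" "\<And>c u. f (scale c u) = s' c (f u)"
  shows "poly_eval s' t (map_poly f p) = f (poly_eval scale t p)"
  by (rule poly_eval_map_poly_on[where E = UNIV])
    (simp_all add: assms additive.add[OF assms(2)])

lemma poly_eval_scale: "poly_eval scale t (map_poly (scale c) p) = scale c (poly_eval scale t p)"
  by (rule poly_eval_map_poly[OF vector_space_axioms additive_scale]) (simp add: mult.commute)

lemma poly_eval_lam_plus:
  assumes "additive D" "\<And>c u. D (scale c u) = scale c (D u)"
  shows "poly_eval scale t (lam_plus D p) = scale t (poly_eval scale t p) + D (poly_eval scale t p)"
  by (simp add: lam_plus_def poly_eval_add poly_eval_pCons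
      poly_eval_map_poly[OF vector_space_axioms assms])

end

text \<open>In characteristic \<open>0\<close> one can avoid Vandermonde determinants: comparing the values at \<open>2t\<close> and
  \<open>t\<close> eliminates the leading term.\<close>

lemma poly_eval_coeff_in_subspace:
  fixes s :: "'k::field_char_0 \<Rightarrow> 'v::ab_group_add \<Rightarrow> 'v"
  assumes "vector_space s" and sub: "module.subspace s E" and ev: "\<And>t. poly_eval s t p \<in> E"
  shows "coeff p i \<in> E"
proof -
  interpret vector_space s by fact
  have *: "\<forall>i<n. c i \<in> E" if "\<And>t. (\<Sum>i<n. s (t ^ i) (c i)) \<in> E" for n and c :: "nat \<Rightarrow> 'v"
    using that
  proof (induction n arbitrary: c)
    case (Suc n)
    let ?b = "\<lambda>i. s (2 ^ i - 2 ^ n) (c i)"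
    have "(\<Sum>i<n. s (t ^ i) (?b i)) =
        (\<Sum>i<Suc n. s ((2 * t) ^ i) (c i)) - s (2 ^ n) (\<Sum>i<Suc n. s (t ^ i) (c i))" for t
      by (simp add: scale_right_distrib scale_sum_right algebra_simps sum_subtractf
          power_mult_distrib)
    then have "\<forall>i<n. ?b i \<in> E"
      using Suc.prems
      by (intro Suc.IH) (simp only: subspace_diff[OF sub] subspace_scale[OF sub])
    then have b: "c i \<in> E" if "i < n" for i
    proof -
      \<comment> \<open>Characteristic 0 enters here: distinct powers of 2 differ, so the factor
        attached to \<open>c i\<close> in \<open>?b i\<close> is invertible.\<close>
      have "(2 :: 'k) ^ i \<noteq> 2 ^ n"
        using that of_nat_eq_iff[of "2 ^ i" "2 ^ n", where 'a = 'k] by simp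
      then have "c i = s (inverse (2 ^ i - 2 ^ n)) (?b i)"
        by simp
      then show ?thesis
        using \<open>\<forall>i<n. ?b i \<in> E\<close> that subspace_scale[OF sub] by metis
    qed
    \<comment> \<open>The eliminated leading coefficient is recovered from the value at t = 1, where
      all weights are 1.\<close>
    have "(\<Sum>i<n. c i) + c n \<in> E"
      using Suc.prems[of 1] by simp
    moreover have "(\<Sum>i<n. c i) \<in> E"
      by (rule subspace_sum[OF sub]) (simp add: b)
    ultimately have "c n \<in> E"
      using subspace_diff[OF sub] by fastforce
    then show ?case
      using b less_Suc_eq by auto
  qed simp
  have "\<forall>i<Suc (degree p). coeff p i \<in> E"
    by (rule *) (use ev in \<open>simp add: poly_eval_def poly_expand_def lessThan_Suc_atMost\<close>)
  then show ?thesis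
    by (cases "i \<le> degree p") (auto simp: coeff_eq_0 subspace_0[OF sub])
qed

lemma poly_eval_eqI:
  fixes s :: "'k::field_char_0 \<Rightarrow> 'v::ab_group_add \<Rightarrow> 'v"
  assumes "vector_space s" "\<And>t. poly_eval s t p = poly_eval s t q"
  shows "p = q"
proof -
  interpret vector_space s by fact
  have "coeff (p - q) i \<in> {0}" for i
    by (rule poly_eval_coeff_in_subspace[OF assms(1)]) (simp_all add: poly_eval_diff assms(2))
  then show ?thesis by (simp add: poly_eq_iff)
qed

section \<open>Evaluation in two variables\<close>

definition poly_eval2 :: "('k::field \<Rightarrow> 'v \<Rightarrow> 'v) \<Rightarrow> 'k \<Rightarrow> 'k \<Rightarrow> 'v::ab_group_add poly poly \<Rightarrow> 'v" where
  "poly_eval2 s l m q = poly_eval s m (poly_eval (\<lambda>c. map_poly (s c)) l q)"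

lemma poly_eval2_eqI:
  fixes s :: "'k::field_char_0 \<Rightarrow> 'v::ab_group_add \<Rightarrow> 'v"
  assumes "vector_space s" "\<And>l m. poly_eval2 s l m p = poly_eval2 s l m q"
  shows "p = q"
proof (rule poly_eval_eqI[OF vector_space_poly[OF assms(1)]])
  fix l
  show "poly_eval (\<lambda>c. map_poly (s c)) l p = poly_eval (\<lambda>c. map_poly (s c)) l q"
    by (rule poly_eval_eqI[OF assms(1)]) (use assms(2) in \<open>simp add: poly_eval2_def\<close>)
qed

context vector_space
begin

lemma additive_poly_eval2: "additive (poly_eval2 scale l m)"
  by unfold_locales (simp add: poly_eval2_def poly_eval_add
      vector_space.poly_eval_add[OF vector_space_poly[OF vector_space_axioms]])

lemma poly_eval2_add: "poly_eval2 scale l m (p + q) = poly_eval2 scale l m p + poly_eval2 scale l m q"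
  by (rule additive.add[OF additive_poly_eval2])

lemma poly_eval2_diff: "poly_eval2 scale l m (p - q) = poly_eval2 scale l m p - poly_eval2 scale l m q"
  by (rule additive.diff[OF additive_poly_eval2])

lemma poly_eval2_poly_expand:
  "poly_eval2 scale l m (poly_expand g p) = poly_expand (\<lambda>i c. poly_eval2 scale l m (g i c)) p"
  by (rule poly_expand_additive[OF additive_poly_eval2])

lemma poly_eval2_const: "poly_eval2 scale l m [:p:] = poly_eval scale m p"
  by (simp add: poly_eval2_def vector_space.poly_eval_const[OF vector_space_poly[OF vector_space_axioms]])

lemma poly_eval2_embed_lam: "poly_eval2 scale l m (embed_lam p) = poly_eval scale l p"
  unfolding poly_eval2_def embed_lam_def
  by (subst poly_eval_map_poly[OF vector_space_poly[OF vector_space_axioms] additive_const_poly])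
    (simp_all add: map_poly_pCons)

lemma poly_eval2_mult_lam: "poly_eval2 scale l m (mult_lam q) = scale l (poly_eval2 scale l m q)"
  by (simp add: poly_eval2_def mult_lam_def poly_eval_scale
      vector_space.poly_eval_pCons[OF vector_space_poly[OF vector_space_axioms]])

lemma poly_eval2_mult_mu: "poly_eval2 scale l m (mult_mu q) = scale m (poly_eval2 scale l m q)"
proof -
  note V = vector_space_poly[OF vector_space_axioms]
  show ?thesis
    unfolding poly_eval2_def mult_mu_def
    by (subst vector_space.poly_eval_map_poly[OF V V additive_pCons_0])
      (simp_all add: map_poly_pCons poly_eval_pCons)
qed

lemma poly_eval2_at_lam_plus_mu:
  "poly_eval2 scale l m (at_lam_plus_mu p) = poly_eval scale (l + m) p"
proof -
  have "poly_eval2 scale l m (((\<lambda>q. mult_lam q + mult_mu q) ^^ n) q) =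
      scale ((l + m) ^ n) (poly_eval2 scale l m q)" for n q
    by (simp flip: funpow_scale, rule funpow_intertwine)
      (simp add: poly_eval2_add poly_eval2_mult_lam poly_eval2_mult_mu scale_left_distrib)
  then show ?thesis
    by (simp add: at_lam_plus_mu_def poly_eval2_poly_expand poly_eval2_const poly_eval_def[of _ "l + m"])
qed

lemma poly_eval2_funpow_mu_minus_lam:
  "poly_eval2 scale l m (((\<lambda>q. mult_mu q - mult_lam q) ^^ n) q) =
    scale ((m - l) ^ n) (poly_eval2 scale l m q)"
  by (simp flip: funpow_scale, rule funpow_intertwine)
    (simp add: poly_eval2_diff poly_eval2_mult_lam poly_eval2_mult_mu scale_left_diff_distrib)

lemma poly_eval2_at_mu_minus_lam:
  "poly_eval2 scale l m (at_mu_minus_lam p) = poly_eval scale (m - l) p"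
  by (simp add: at_mu_minus_lam_def poly_eval2_poly_expand poly_eval2_funpow_mu_minus_lam
      poly_eval2_const poly_eval_def[of _ "m - l"])

text \<open>\<open>conf_commutator\<close> expands over the coefficients of the inner map. Linearity
  of the outer map over the base field pulls out the powers of the evaluation point, so the
  expansion collapses to a composition of operators.\<close>

lemma poly_eval2_conf_commutator:
  assumes "additive \<phi>" "\<And>c u. \<phi> (scale c u) = map_poly (scale c) (\<phi> u)"
    "additive \<psi>" "\<And>c u. \<psi> (scale c u) = map_poly (scale c) (\<psi> u)"
  shows "poly_eval2 scale l m (conf_commutator \<phi> \<psi> v) =
    poly_eval scale l (\<phi> (poly_eval scale (m - l) (\<psi> v)))
    - poly_eval scale (m - l) (\<psi> (poly_eval scale l (\<phi> v)))"
proof -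
  have *: "poly_eval scale t (\<chi> (poly_eval scale r p)) =
      poly_expand (\<lambda>i c. scale (r ^ i) (poly_eval scale t (\<chi> c))) p"
    if "additive \<chi>" "\<And>c u. \<chi> (scale c u) = map_poly (scale c) (\<chi> u)" for t r p and \<chi> :: "'b \<Rightarrow> 'b poly"
    by (simp add: poly_eval_poly_expand poly_eval_scale
        poly_eval_linear[of \<chi> "\<lambda>c. map_poly (scale c)", OF that])
  have lam: "poly_eval2 scale l m ((mult_lam ^^ n) q) = scale (l ^ n) (poly_eval2 scale l m q)" for n q
    by (simp flip: funpow_scale, rule funpow_intertwine) (rule poly_eval2_mult_lam)
  show ?thesis
    by (simp only: conf_commutator_def poly_eval2_diff poly_eval2_poly_expand *[OF assms(1,2)]
        *[OF assms(3,4)] poly_eval2_funpow_mu_minus_lam poly_eval2_embed_lam lam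
        poly_eval2_at_mu_minus_lam)
qed

lemma poly_eval2_map_poly:
  assumes "vector_space s'" "additive f" "\<And>c u. f (scale c u) = s' c (f u)"
  shows "poly_eval2 s' l m (map_poly (map_poly f) q) = f (poly_eval2 scale l m q)"
proof -
  have "poly_eval (\<lambda>c. map_poly (s' c)) l (map_poly (map_poly f) q) =
      map_poly f (poly_eval (\<lambda>c. map_poly (scale c)) l q)"
  proof (rule vector_space.poly_eval_map_poly)
    show "map_poly f (map_poly (scale c) p) = map_poly (s' c) (map_poly f p)" for c p
      using vector_space.additive_scale[OF assms(1)]
      by (simp add: poly_eq_iff coeff_map_poly additive.zero assms)
  qed (simp_all add: vector_space_poly assms vector_space_axioms additive_map_poly)
  then show ?thesis
    by (simp add: poly_eval2_def poly_eval_map_poly[OF assms])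
qed

lemma poly_eval2_lam_plus:
  assumes "additive D" "\<And>c u. D (scale c u) = scale c (D u)"
  shows "poly_eval2 scale l m (map_poly (lam_plus D) q) =
    scale m (poly_eval2 scale l m q) + D (poly_eval2 scale l m q)"
proof -
  note V = vector_space_poly[OF vector_space_axioms]
  have "lam_plus D (map_poly (scale c) p) = map_poly (scale c) (lam_plus D p)" for c p
    by (simp add: poly_eq_iff lam_plus_def coeff_map_poly coeff_pCons assms scale_right_distrib
        additive.zero[OF assms(1)] split: nat.splits)
  then show ?thesis
    by (simp add: poly_eval2_def poly_eval_lam_plus[OF assms]
        vector_space.poly_eval_map_poly[OF V V additive_lam_plus[OF assms(1)]])
qed

end

section \<open>Modules over differential operators\<close>

lemma lam_plus_pCons:
  "additive D \<Longrightarrow> lam_plus D (pCons c p) = pCons (D c) ([:c:] + lam_plus D p)"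
  using additive.zero[of D] by (simp add: lam_plus_def map_poly_pCons)

lemma dop_mult_pCons: "dop_mult d (pCons a p) b = smult a b + dop_mult d p (lam_plus d b)"
  by (simp add: dop_mult_def poly_expand_pCons funpow_Suc_right del: funpow.simps)

lemma dop_mult_0: "dop_mult d 0 b = 0"
  by (simp add: dop_mult_def poly_expand_0)

text \<open>A[\<partial>] is the Ore extension of \<open>A\<close> by \<open>d\<close>: a module
  over it is an \<open>A\<close>-module with an additive operator \<open>D\<close> satisfying the
  single commutation relation \<open>D_m\<close>. The last two assumptions say that
  \<open>act\<close> writes coefficients to the left of powers of \<open>D\<close>.\<close>

lemma dop_moduleI:
  fixes act :: "'a::{comm_ring,comm_monoid_mult} poly \<Rightarrow> 'e::ab_group_add \<Rightarrow> 'e"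
  assumes d: "additive d"
    and E: "0 \<in> E" "\<And>u v. u \<in> E \<Longrightarrow> v \<in> E \<Longrightarrow> u + v \<in> E" "\<And>u. u \<in> E \<Longrightarrow> - u \<in> E"
    and D: "\<And>u. u \<in> E \<Longrightarrow> D u \<in> E"
      "\<And>u v. u \<in> E \<Longrightarrow> v \<in> E \<Longrightarrow> D (u + v) = D u + D v"
    and m: "\<And>a u. u \<in> E \<Longrightarrow> m a u \<in> E"
      "\<And>a u v. u \<in> E \<Longrightarrow> v \<in> E \<Longrightarrow> m a (u + v) = m a u + m a v"
      "\<And>a b u. u \<in> E \<Longrightarrow> m (a + b) u = m a u + m b u"
      "\<And>a b u. u \<in> E \<Longrightarrow> m (a * b) u = m a (m b u)"
      "\<And>u. u \<in> E \<Longrightarrow> m 1 u = u"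
    and D_m: "\<And>a u. u \<in> E \<Longrightarrow> D (m a u) = m (d a) u + m a (D u)"
    and act_0: "\<And>u. u \<in> E \<Longrightarrow> act 0 u = 0"
    and act_pCons: "\<And>a p u. u \<in> E \<Longrightarrow> act (pCons a p) u = m a u + act p (D u)"
  shows "dop_module d E act"
proof
  have m_0: "m 0 u = 0" if "u \<in> E" for u
    using m(3)[OF that, of 0 0] by simp
  have act_const: "act [:a:] u = m a u" if "u \<in> E" for a u
    using that by (simp add: act_pCons act_0 D)
  show closed: "act a u \<in> E" if "u \<in> E" for a u
    using that by (induction a arbitrary: u) (simp_all add: act_0 act_pCons E D m)
  show "act a (u + v) = act a u + act a v" if "u \<in> E" "v \<in> E" for a u v
    using that by (induction a arbitrary: u v) (simp_all add: act_0 act_pCons E D m algebra_simps)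
  show add_left: "act (a + b) u = act a u + act b u" if "u \<in> E" for a b u
    using that
  proof (induction a arbitrary: b u)
    case (pCons a p)
    then show ?case
      by (cases b) (simp add: act_pCons D m algebra_simps)
  qed (simp add: act_0)
  \<comment> \<open>By \<open>dop_mult_pCons\<close>, products are assembled from left
    multiplication by an element of \<open>A\<close> and left multiplication by \<partial>; this
    fact and the next treat these two cases.\<close>
  have smult: "act (smult a b) u = m a (act b u)" if "u \<in> E" for a b u
    using that
  proof (induction b arbitrary: u)
    case 0
    then show ?case
      using m(2)[of 0 0 a] E(1) by (simp add: act_0)
  qed (simp add: act_pCons m D closed)
  have lam: "act (lam_plus d b) u = D (act b u)" if "u \<in> E" for b u
    using that
  proof (induction b arbitrary: u)
    case 0
    then show ?case
      using D(2)[of 0 0] E(1) by (simp add: act_0 lam_plus_def)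
  next
    case (pCons c p)
    then show ?case
      by (simp add: lam_plus_pCons[OF d] act_pCons add_left D m D_m closed act_0 algebra_simps
          flip: add_pCons)
  qed
  show "act (dop_mult d a b) u = act a (act b u)" if "u \<in> E" for a b u
    using that
    by (induction a arbitrary: b u)
      (simp_all add: dop_mult_0 dop_mult_pCons add_left act_0 act_pCons smult lam closed)
  show "act [:1:] u = u" if "u \<in> E" for u
    using that by (simp add: act_const m)
qed (use E in auto)

context differential_algebra
begin

lemma additive_d: "additive d"
  by unfold_locales (rule d_add)

lemma d_one: "d 1 = 0"
  using d_mult[of 1 1] by simp

lemma d_scale_one: "d (scale c 1) = 0"
  by (simp add: d_scale d_one)

lemma scale_conv_mult: "scale c a = scale c 1 * a"
  using scale_mult[of c 1 a] by simp

text \<open>Because \<open>d 1 = 0\<close>, (x+\<partial>)^i applied to x is just x^(i+1). This is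
  what splits off the lowest coefficient of an operator acting on an abstract module, in
  \<open>act_pCons\<close>.\<close>

lemma dop_mult_del: "dop_mult d p [:0, 1:] = pCons 0 p"
proof -
  have *: "lam_plus d (monom 1 k) = monom 1 (Suc k)" for k
    by (simp add: lam_plus_def map_poly_monom additive.zero[OF additive_d] d_one monom_Suc)
  have "(lam_plus d ^^ i) (monom 1 k) = monom 1 (i + k)" for i k
    by (induction i) (simp_all add: *)
  from this[of _ 1] have "(lam_plus d ^^ i) [:0, 1:] = monom 1 (Suc i)" for i
    by (simp add: monom_Suc monom_0)
  then have "dop_mult d p [:0, 1:] = pCons 0 (poly_expand (\<lambda>i c. monom c i) p)"
    by (simp add: dop_mult_def smult_monom monom_Suc poly_expand_additive[OF additive_pCons_0])
  also have "poly_expand (\<lambda>i c. monom c i) p = p"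
    by (simp add: poly_expand_def poly_as_sum_of_monoms)
  finally show ?thesis .
qed

end

section \<open>Modules over A[\<partial>] carried by a whole type\<close>

locale dalg_module = differential_algebra scale d + dop_module d UNIV act
  for scale :: "'k::field_char_0 \<Rightarrow> 'a::{comm_ring,comm_monoid_mult} \<Rightarrow> 'a"
    and d :: "'a \<Rightarrow> 'a"
    and act :: "'a poly \<Rightarrow> 'm::ab_group_add \<Rightarrow> 'm"
begin

abbreviation del :: "'m \<Rightarrow> 'm" where "del \<equiv> del_act act"
abbreviation alg :: "'a \<Rightarrow> 'm \<Rightarrow> 'm" where "alg \<equiv> alg_act act"
abbreviation scal :: "'k \<Rightarrow> 'm \<Rightarrow> 'm" where "scal \<equiv> scalar_act scale act"

lemma additive_act: "additive (act a)"
  by unfold_locales (simp add: act_add_right)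

lemma additive_act_left: "additive (\<lambda>a. act a u)"
  by unfold_locales (simp add: act_add_left)

lemma additive_alg: "additive (alg a)"
  using additive_act by (simp add: alg_act_def[abs_def])

lemma additive_alg_left: "additive (\<lambda>a. alg a u)"
  by unfold_locales (simp add: alg_act_def flip: act_add_left)

lemma additive_del: "additive del"
  using additive_act by (simp add: del_act_def[abs_def])

lemma alg_0 [simp]: "alg a 0 = 0" "alg 0 u = 0"
  by (rule additive.zero[OF additive_alg] additive.zero[OF additive_alg_left])+

lemma del_0 [simp]: "del 0 = 0"
  by (rule additive.zero[OF additive_del])

lemmas alg_add = additive.add[OF additive_alg] additive.add[OF additive_alg_left]
lemmas alg_diff = additive.diff[OF additive_alg] additive.diff[OF additive_alg_left]
lemmas alg_minus = additive.minus[OF additive_alg] additive.minus[OF additive_alg_left]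
lemmas del_add = additive.add[OF additive_del]
lemmas del_diff = additive.diff[OF additive_del]

lemma alg_one [simp]: "alg 1 u = u"
  by (simp add: alg_act_def act_one)

lemma alg_mult: "alg (a * b) u = alg a (alg b u)"
  using act_mult[of u "[:a:]" "[:b:]"]
  by (simp add: alg_act_def dop_mult_pCons dop_mult_0)

lemma alg_commute: "alg a (alg b u) = alg b (alg a u)"
  by (metis alg_mult mult.commute)

lemma act_0: "act 0 u = 0"
  by (rule additive.zero[OF additive_act_left])

lemma act_pCons: "act (pCons a p) u = alg a u + act p (del u)"
proof -
  have "pCons a p = [:a:] + dop_mult d p [:0, 1:]"
    by (simp add: dop_mult_del)
  then show ?thesis
    by (simp add: act_add_left act_mult alg_act_def del_act_def)
qed

lemma del_alg: "del (alg a u) = alg (d a) u + alg a (del u)"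
proof -
  have "dop_mult d [:0, 1:] [:a:] = [:d a, a:]"
    by (simp add: dop_mult_pCons dop_mult_0 lam_plus_pCons additive_d)
      (simp add: lam_plus_def)
  then show ?thesis
    using act_mult[of u "[:0, 1:]" "[:a:]"] act_pCons[of "d a" "[:a:]" u]
    by (simp add: alg_act_def del_act_def)
qed

lemma scal_conv_alg: "scal c u = alg (scale c 1) u"
  by (simp add: scalar_act_def)

lemma alg_scale: "alg (scale c a) u = scal c (alg a u)"
  by (metis alg_mult scalar_act_def scale_conv_mult)

lemma alg_scal: "alg a (scal c u) = scal c (alg a u)"
  by (simp add: scal_conv_alg alg_commute)

lemma del_scal: "del (scal c u) = scal c (del u)"
  by (simp add: scal_conv_alg del_alg d_scale_one)

sublocale M: vector_space scal
  by unfold_locales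
    (simp_all add: scal_conv_alg alg_add scale_left_distrib flip: alg_mult,
      simp flip: scale_conv_mult)

lemma symbol_act_0: "\<sigma> 0 = 0 \<Longrightarrow> symbol_act act \<sigma> 0 u = 0"
  by (simp add: symbol_act_def poly_expand_0)

lemma symbol_act_pCons:
  "\<sigma> 0 = 0 \<Longrightarrow> symbol_act act \<sigma> (pCons a p) u =
    map_poly (\<lambda>c. alg c u) (\<sigma> a) + symbol_act act \<sigma> p (del u)"
  by (simp add: symbol_act_def poly_expand_pCons funpow_Suc_right del: funpow.simps)

lemma shifted_act_0: "shifted_act act 0 q = 0"
  by (simp add: shifted_act_def poly_expand_0 poly_eq_iff coeff_map_poly)

lemma shifted_act_pCons:
  "shifted_act act (pCons a p) q = map_poly (alg a) q + shifted_act act p (lam_plus del q)"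
proof -
  have "map_poly (alg 0) q = 0" for q
    by (simp add: poly_eq_iff coeff_map_poly)
  then show ?thesis
    by (simp add: shifted_act_def poly_expand_pCons funpow_Suc_right del: funpow.simps)
qed

text \<open>Elements of \<open>A\<close> and \<partial> generate A[\<partial>], so compatibility
  with these two suffices, by induction on the symbol. It serves twice: for the condition defining
  \<open>gauge\<close>, and for axiom (i) of an algebroid with \<phi> a bracket operator; the latter
  is why a carrier \<open>E\<close> is allowed.\<close>

lemma leibniz_act:
  assumes E: "\<And>u. u \<in> E \<Longrightarrow> del u \<in> E" "\<And>a u. u \<in> E \<Longrightarrow> alg a u \<in> E"
      "\<And>a u. u \<in> E \<Longrightarrow> act a u \<in> E"
    and \<phi>: "\<And>u v. u \<in> E \<Longrightarrow> v \<in> E \<Longrightarrow> \<phi> (u + v) = \<phi> u + \<phi> v"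
      "\<And>u. u \<in> E \<Longrightarrow> \<phi> (del u) = lam_plus del (\<phi> u)"
      "\<And>a u. u \<in> E \<Longrightarrow> \<phi> (alg a u) = map_poly (alg a) (\<phi> u) + map_poly (\<lambda>c. alg c u) (\<sigma> a)"
    and \<sigma>: "\<sigma> 0 = 0" and u: "u \<in> E"
  shows "\<phi> (act a u) = shifted_act act a (\<phi> u) + symbol_act act \<sigma> a u"
  using u
proof (induction a arbitrary: u)
  case 0
  then have "0 \<in> E"
    using E(3)[of u 0] by (simp add: act_0)
  then show ?case
    using \<phi>(1)[of 0 0] by (simp add: act_0 shifted_act_0 symbol_act_0[where \<sigma> = \<sigma>, OF \<sigma>])
next
  case (pCons a p)
  then show ?case
    by (simp add: act_pCons shifted_act_pCons symbol_act_pCons[where \<sigma> = \<sigma>, OF \<sigma>] \<phi> E)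
qed

end

lemma dalg_module_regular:
  assumes "differential_algebra scale d"
  shows "dalg_module scale d (regular_act d)"
proof -
  interpret differential_algebra scale d by fact
  have "dop_module d UNIV (regular_act d)"
    by (rule dop_moduleI[where D = d and m = "(*)"])
      (simp_all add: additive_d d_add d_mult algebra_simps regular_act_def poly_expand_0
        poly_expand_pCons funpow_Suc_right del: funpow.simps)
  then show ?thesis
    by (simp add: dalg_module_def differential_algebra_axioms)
qed

lemma alg_act_regular: "alg_act (regular_act d) = (*)"
  by (simp add: fun_eq_iff alg_act_def regular_act_def poly_expand_const)

lemma del_act_regular: "del_act (regular_act d) = d"
  by (simp add: fun_eq_iff del_act_def regular_act_def poly_expand_pCons poly_expand_0)

lemma (in differential_algebra) scalar_act_regular: "scalar_act scale (regular_act d) = scale"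
  by (simp add: fun_eq_iff scalar_act_def alg_act_regular flip: scale_conv_mult)

section \<open>The action of differential operators on conformal maps\<close>

context dalg_module
begin

text \<open>\<open>p(t+\<partial>)\<close>, where \<open>\<partial>\<close> acts on \<open>a\<close>\<close>

definition subst_act :: "'k \<Rightarrow> 'a \<Rightarrow> 'm poly \<Rightarrow> 'm" where
  "subst_act t a p = poly_expand (\<lambda>i. alg (((\<lambda>b. scale t b + d b) ^^ i) a)) p"

lemma additive_scale_plus_d: "additive (\<lambda>b. scale t b + d b)"
  by (intro additive_add additive_scale additive_d)

lemma subst_act_pCons: "subst_act t a (pCons w p) = alg a w + subst_act t (scale t a + d a) p"
  by (simp add: subst_act_def poly_expand_pCons funpow_Suc_right del: funpow.simps)

lemma additive_subst_act: "additive (subst_act t a)"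
  unfolding subst_act_def[abs_def] by (intro additive_poly_expand additive_alg)

lemma subst_act_0 [simp]: "subst_act t a 0 = 0"
  by (rule additive.zero[OF additive_subst_act])

lemma subst_act_add_left: "subst_act t (a + b) p = subst_act t a p + subst_act t b p"
proof (induction p arbitrary: a b)
  case (pCons w p)
  have "scale t (a + b) + d (a + b) = (scale t a + d a) + (scale t b + d b)"
    by (rule additive.add[OF additive_scale_plus_d])
  then show ?case
    by (simp only: subst_act_pCons pCons alg_add ac_simps)
qed simp

lemma additive_subst_act_left: "additive (\<lambda>a. subst_act t a p)"
  by unfold_locales (rule subst_act_add_left)

lemma subst_act_scale: "subst_act t (scale c a) p = scal c (subst_act t a p)"
proof (induction p arbitrary: a)
  case (pCons w p)
  have "scale t (scale c a) + d (scale c a) = scale c (scale t a + d a)"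
    by (simp add: d_scale scale_right_distrib mult.commute)
  then show ?case
    by (simp only: subst_act_pCons pCons alg_scale M.scale_right_distrib)
qed simp

lemma subst_act_scal: "subst_act t a (map_poly (scal c) p) = scal c (subst_act t a p)"
  by (simp add: subst_act_def poly_expand_map_poly poly_expand_additive[OF M.additive_scale] alg_scal)

text \<open>The variable becomes t plus \<partial> acting on \<open>a\<close>, and
  \<open>lam_plus\<close> adds \<partial> acting on the coefficients of \<open>p\<close>; by the
  product rule the two derivations add up to \<partial> on the result.\<close>

lemma subst_act_lam_plus:
  "subst_act t a (lam_plus del p) = scal t (subst_act t a p) + del (subst_act t a p)"
proof (induction p arbitrary: a)
  case (pCons w p)
  show ?case
    by (simp add: lam_plus_pCons[OF additive_del] subst_act_pCons additive.add[OF additive_subst_act]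
        pCons del_add del_alg alg_add alg_scale M.scale_right_distrib)
qed (simp add: lam_plus_def)

lemma subst_act_one: "subst_act t 1 p = poly_eval scal t p"
proof -
  have "((\<lambda>b. scale t b + d b) ^^ i) 1 = scale (t ^ i) 1" for i
    by (induction i) (simp_all add: d_scale_one)
  then show ?thesis
    by (simp add: subst_act_def poly_eval_def scal_conv_alg[abs_def])
qed

end

text \<open>\<open>A\<close> as a module over itself: what is shown for maps \<phi> on
  \<open>M\<close> becomes available for derivations \<sigma> on \<open>A\<close>.\<close>

sublocale dalg_module \<subseteq> R: dalg_module scale d "regular_act d"
  rewrites "scalar_act scale (regular_act d) = scale"
    and "del_act (regular_act d) = d"
    and "alg_act (regular_act d) = (*)"
proof -
  show "dalg_module scale d (regular_act d)"
    by (rule dalg_module_regular) (rule differential_algebra_axioms)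
qed (simp_all add: scalar_act_regular del_act_regular alg_act_regular fun_eq_iff)

lemma adj_subst_pCons:
  assumes "additive D"
  shows "adj_subst D (pCons c p) = [:c:] - lam_plus D (adj_subst D p)"
proof -
  have *: "additive (\<lambda>q. - lam_plus D q)"
    using additive.add[OF additive_lam_plus[OF assms]] by (simp add: additive_def)
  have "((\<lambda>q. - lam_plus D q) ^^ i) [:0:] = 0" for i
    using additive.zero[OF additive_funpow[OF *]] by simp
  then show ?thesis
    by (simp add: adj_subst_def poly_expand_pCons poly_expand_additive[OF *])
qed

lemma adj_subst_0: "adj_subst D 0 = 0"
  by (simp add: adj_subst_def poly_expand_0)

context dalg_module
begin

lemma poly_eval_alg_left:
  "poly_eval scal t (map_poly (\<lambda>b. alg b w) q) = alg (poly_eval scale t q) w"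
  by (rule poly_eval_map_poly[OF M.vector_space_axioms additive_alg_left alg_scale])

lemma poly_eval_alg: "poly_eval scal t (map_poly (alg a) q) = alg a (poly_eval scal t q)"
  by (rule M.poly_eval_map_poly[OF M.vector_space_axioms additive_alg alg_scal])

lemma poly_eval_lam_plus_del:
  "poly_eval scal t (lam_plus del q) = scal t (poly_eval scal t q) + del (poly_eval scal t q)"
  by (rule M.poly_eval_lam_plus[OF additive_del del_scal])

lemma conf_act_const:
  "conf_act d act [:a:] \<phi> u =
    poly_expand (\<lambda>i w. map_poly (\<lambda>b. alg b w) ((lam_plus d ^^ i) [:a:])) (\<phi> u)"
  by (simp add: conf_act_def adj_subst_pCons[OF additive_d] adj_subst_0 lam_plus_def)

text \<open>At \<lambda> = t the operator \<lambda>+\<partial> on A[\<lambda>] becomes b \<mapsto>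
  tb + d b on \<open>A\<close>, and the adjoint symbol of a constant is that constant.\<close>

lemma poly_eval_conf_act: "poly_eval scal t (conf_act d act [:a:] \<phi> u) = subst_act t a (\<phi> u)"
proof -
  have "poly_eval scale t ((lam_plus d ^^ i) [:a:]) = ((\<lambda>b. scale t b + d b) ^^ i) a" for i
    using funpow_intertwine[of "poly_eval scale t" "lam_plus d",
        OF poly_eval_lam_plus[OF additive_d d_scale]]
    by simp
  then show ?thesis
    by (simp add: conf_act_const M.poly_eval_poly_expand poly_eval_alg_left subst_act_def)
qed

lemma subst_act_alg_left:
  "subst_act t a (map_poly (\<lambda>c. alg c w) q) = alg (R.subst_act t a q) w"
  by (induction q arbitrary: a) (simp_all add: map_poly_pCons subst_act_pCons R.subst_act_pCons
      alg_mult alg_add)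

lemma subst_act_alg: "subst_act t a (map_poly (alg b) q) = alg b (subst_act t a q)"
  by (induction q arbitrary: a)
    (simp_all add: map_poly_pCons subst_act_pCons alg_add alg_commute[of _ b])

text \<open>This is associativity of the action of \<open>A\<close>. The inner action produces the
  factors (\<lambda>+\<partial>)^i b, and substituting t+\<partial> with \<partial> acting on
  \<open>a\<close> turns them into (t+\<partial>)^i (ab), by \<open>subst_act_lam_plus\<close> for
  the regular module.\<close>

lemma subst_act_conf_act: "subst_act t a (conf_act d act [:b:] \<phi> u) = subst_act t (a * b) (\<phi> u)"
proof -
  have "R.subst_act t a ((lam_plus d ^^ i) [:b:]) = ((\<lambda>c. scale t c + d c) ^^ i) (a * b)" for i
    using funpow_intertwine[of "R.subst_act t a" "lam_plus d", OF R.subst_act_lam_plus]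
    by (simp add: R.subst_act_pCons)
  then show ?thesis
    by (simp add: conf_act_const poly_expand_additive[OF additive_subst_act] subst_act_alg_left
        subst_act_def[of _ "a * b"])
qed

lemma additive_conf_act: "additive (conf_act d act a)"
proof
  fix \<phi> \<psi> :: "'m \<Rightarrow> 'm poly"
  have "additive (\<lambda>w. map_poly (\<lambda>b. alg b w) q)" for q :: "'a poly"
    by unfold_locales (simp add: poly_eq_iff coeff_map_poly alg_add)
  then show "conf_act d act a (\<phi> + \<psi>) = conf_act d act a \<phi> + conf_act d act a \<psi>"
    by (simp add: fun_eq_iff conf_act_def additive.add[OF additive_poly_expand])
qed

lemma conf_act_0: "conf_act d act 0 \<phi> = 0"
  using additive.zero[OF additive_funpow[OF additive_lam_plus[OF additive_d]]]
  by (simp add: fun_eq_iff conf_act_def adj_subst_0 poly_expand_def)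

text \<open>Both sides get one more factor -(\<lambda>+\<partial>) on the adjoint symbol of
  \<open>p\<close>: on the left from the adjoint of p(\<partial>)\<partial>, on the right because
  multiplying \<phi> by -\<lambda> raises every expansion index by one.\<close>

lemma conf_act_pCons:
  "conf_act d act (pCons a p) \<phi> = conf_act d act [:a:] \<phi> + conf_act d act p (\<lambda>u. - pCons 0 (\<phi> u))"
proof
  fix u
  let ?C = "\<lambda>Q p. poly_expand (\<lambda>i w. map_poly (\<lambda>b. alg b w) ((lam_plus d ^^ i) Q)) p"
  have add_w: "additive (\<lambda>w. map_poly (\<lambda>b. alg b w) q)" for q :: "'a poly"
    by unfold_locales (simp add: poly_eq_iff coeff_map_poly alg_add)
  have "?C (P - lam_plus d Q) p = ?C P p - ?C (lam_plus d Q) p" for P Q p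
    by (simp add: additive.diff[OF additive_funpow[OF additive_lam_plus[OF additive_d]]]
        additive.diff[OF additive_map_poly[OF additive_alg_left]] poly_expand_def sum_subtractf)
  moreover have "?C Q (- pCons 0 p) = - ?C (lam_plus d Q) p" for Q p
  proof -
    have "?C Q (- pCons 0 p) = - ?C Q (pCons 0 p)"
      by (rule additive.minus[OF additive_poly_expand[OF add_w]])
    also have "?C Q (pCons 0 p) = ?C (lam_plus d Q) p"
      by (subst poly_expand_pCons)
        (simp_all add: poly_eq_iff coeff_map_poly funpow_Suc_right del: funpow.simps)
    finally show ?thesis .
  qed
  ultimately show "conf_act d act (pCons a p) \<phi> u =
      (conf_act d act [:a:] \<phi> + conf_act d act p (\<lambda>u. - pCons 0 (\<phi> u))) u"
    by (simp add: conf_act_const) (simp add: conf_act_def adj_subst_pCons[OF additive_d])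
qed

lemma conf_map_eqI:
  "(\<And>t u. poly_eval scal t (\<phi> u) = poly_eval scal t (\<psi> u)) \<Longrightarrow> \<phi> = \<psi>"
  by (rule ext, rule poly_eval_eqI[OF M.vector_space_axioms])

lemma conf_act_one: "conf_act d act [:1:] \<phi> = \<phi>"
  by (rule conf_map_eqI) (simp add: poly_eval_conf_act subst_act_one)

text \<open>The module laws hold for arbitrary maps into M[\<lambda>], conformal or not, so they
  carry no membership conditions; closure of CEnd and of the Leibniz pairs is a separate
  matter.\<close>

lemma dalg_module_conf_act: "dalg_module scale d (conf_act d act)"
proof -
  have "dop_module d UNIV (conf_act d act)"
  proof (rule dop_moduleI[where D = "\<lambda>\<phi> u. - pCons 0 (\<phi> u)" and m = "\<lambda>a. conf_act d act [:a:]"])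
    show "(\<lambda>u. - pCons 0 (conf_act d act [:a:] \<phi> u)) =
        conf_act d act [:d a:] \<phi> + conf_act d act [:a:] (\<lambda>u. - pCons 0 (\<phi> u))" for a \<phi>
      by (rule conf_map_eqI)
        (simp add: M.poly_eval_minus M.poly_eval_add M.poly_eval_pCons poly_eval_conf_act subst_act_pCons
          additive.minus[OF additive_subst_act] subst_act_add_left subst_act_scale)
    show "conf_act d act [:a + b:] \<phi> = conf_act d act [:a:] \<phi> + conf_act d act [:b:] \<phi>" for a b \<phi>
      by (rule conf_map_eqI) (simp add: M.poly_eval_add poly_eval_conf_act subst_act_add_left)
    show "conf_act d act [:a * b:] \<phi> = conf_act d act [:a:] (conf_act d act [:b:] \<phi>)" for a b \<phi>
      by (rule conf_map_eqI) (simp add: poly_eval_conf_act subst_act_conf_act)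
    show "conf_act d act (pCons a p) \<phi> =
        conf_act d act [:a:] \<phi> + conf_act d act p (\<lambda>u. - pCons 0 (\<phi> u))" for a p \<phi>
      by (rule conf_act_pCons)
  qed (simp_all add: additive_d additive.add[OF additive_conf_act] conf_act_0 conf_act_one fun_eq_iff)
  then show ?thesis
    by (simp add: dalg_module_def differential_algebra_axioms)
qed

lemma del_act_conf_act: "del_act (conf_act d act) \<phi> = (\<lambda>u. - pCons 0 (\<phi> u))"
  using conf_act_pCons[of 0 "[:1:]" \<phi>]
  by (simp add: del_act_def conf_act_one conf_act_0)

section \<open>Conformal endomorphisms over a conformal derivation\<close>

text \<open>The condition defining \<open>gauge\<close>, restricted to operators of order 0;
  \<open>gauge_iff\<close> recovers the full condition from it.\<close>

definition leibniz :: "('m \<Rightarrow> 'm poly) \<Rightarrow> ('a \<Rightarrow> 'a poly) \<Rightarrow> bool" where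
  "leibniz \<phi> \<sigma> \<longleftrightarrow>
    (\<forall>a u. \<phi> (alg a u) = map_poly (alg a) (\<phi> u) + map_poly (\<lambda>c. alg c u) (\<sigma> a))"

text \<open>Membership becomes a set of identities for honest operators on \<open>M\<close>, one
  family per scalar t, so that closure properties reduce to linear algebra.\<close>

lemma CEnd_iff_poly_eval:
  "\<phi> \<in> CEnd scal del \<longleftrightarrow>
    (\<forall>t u v. poly_eval scal t (\<phi> (u + v)) = poly_eval scal t (\<phi> u) + poly_eval scal t (\<phi> v)) \<and>
    (\<forall>t c u. poly_eval scal t (\<phi> (scal c u)) = scal c (poly_eval scal t (\<phi> u))) \<and>
    (\<forall>t u. poly_eval scal t (\<phi> (del u)) =
      scal t (poly_eval scal t (\<phi> u)) + del (poly_eval scal t (\<phi> u)))" (is "_ \<longleftrightarrow> ?R")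
proof
  assume "\<phi> \<in> CEnd scal del"
  then show ?R
    by (simp add: CEnd_def M.poly_eval_add M.poly_eval_scale poly_eval_lam_plus_del)
next
  note eqI = poly_eval_eqI[OF M.vector_space_axioms]
  assume ?R
  then show "\<phi> \<in> CEnd scal del"
    unfolding CEnd_def
    by (intro CollectI conjI allI; intro eqI)
      (simp_all add: M.poly_eval_add M.poly_eval_scale poly_eval_lam_plus_del)
qed

lemma leibniz_iff_poly_eval:
  "leibniz \<phi> \<sigma> \<longleftrightarrow> (\<forall>t a u. poly_eval scal t (\<phi> (alg a u)) =
    alg a (poly_eval scal t (\<phi> u)) + alg (poly_eval scale t (\<sigma> a)) u)" (is "_ \<longleftrightarrow> ?R")
proof
  assume "leibniz \<phi> \<sigma>"
  then show ?R
    by (simp add: leibniz_def M.poly_eval_add poly_eval_alg poly_eval_alg_left)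
next
  assume ?R
  then show "leibniz \<phi> \<sigma>"
    unfolding leibniz_def
    by (intro allI poly_eval_eqI[OF M.vector_space_axioms])
      (simp add: M.poly_eval_add poly_eval_alg poly_eval_alg_left)
qed

lemmas R_poly_eval_conf_act = dalg_module.poly_eval_conf_act
    [OF R.dalg_module_axioms, unfolded scalar_act_regular]
  and R_conf_act_pCons = dalg_module.conf_act_pCons[OF R.dalg_module_axioms]
  and R_conf_act_0 = dalg_module.conf_act_0[OF R.dalg_module_axioms]
  and R_CEnd_iff_poly_eval = dalg_module.CEnd_iff_poly_eval
    [OF R.dalg_module_axioms, unfolded scalar_act_regular del_act_regular]

lemma CEnd_additive: "\<phi> \<in> CEnd scal del \<Longrightarrow> additive \<phi>"
  by unfold_locales (simp add: CEnd_def)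

lemma CEnd_scal: "\<phi> \<in> CEnd scal del \<Longrightarrow> \<phi> (scal c u) = map_poly (scal c) (\<phi> u)"
  by (simp add: CEnd_def)

lemma CEnd_conf_act_const: "\<phi> \<in> CEnd scal del \<Longrightarrow> conf_act d act [:a:] \<phi> \<in> CEnd scal del"
  by (simp add: CEnd_iff_poly_eval[of "conf_act d act [:a:] \<phi>"] poly_eval_conf_act)
    (simp add: CEnd_def additive.add[OF additive_subst_act] subst_act_scal subst_act_lam_plus)

lemma leibniz_conf_act_const:
  "leibniz \<phi> \<sigma> \<Longrightarrow> leibniz (conf_act d act [:a:] \<phi>) (conf_act d (regular_act d) [:a:] \<sigma>)"
  by (simp add: leibniz_iff_poly_eval[of "conf_act d act [:a:] \<phi>"] poly_eval_conf_act
      R_poly_eval_conf_act)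
    (simp add: leibniz_def additive.add[OF additive_subst_act] subst_act_alg subst_act_alg_left)

lemma CEnd_del: "\<phi> \<in> CEnd scal del \<Longrightarrow> (\<lambda>u. - pCons 0 (\<phi> u)) \<in> CEnd scal del"
  by (simp add: CEnd_iff_poly_eval M.poly_eval_minus M.poly_eval_pCons M.scale_right_distrib
      M.scale_right_diff_distrib del_diff del_scal mult.commute additive.minus[OF additive_del])

lemma leibniz_del: "leibniz \<phi> \<sigma> \<Longrightarrow> leibniz (\<lambda>u. - pCons 0 (\<phi> u)) (\<lambda>a. - pCons 0 (\<sigma> a))"
  by (simp add: leibniz_iff_poly_eval M.poly_eval_minus M.poly_eval_pCons M.scale_right_diff_distrib
      alg_minus poly_eval_minus poly_eval_pCons alg_scale alg_scal)

lemma CEnd_add: "\<phi> \<in> CEnd scal del \<Longrightarrow> \<psi> \<in> CEnd scal del \<Longrightarrow> \<phi> + \<psi> \<in> CEnd scal del"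
  by (simp add: CEnd_iff_poly_eval M.poly_eval_add M.scale_right_distrib del_add)

lemma leibniz_add: "leibniz \<phi> \<sigma> \<Longrightarrow> leibniz \<psi> \<tau> \<Longrightarrow> leibniz (\<phi> + \<psi>) (\<sigma> + \<tau>)"
  by (simp add: leibniz_iff_poly_eval M.poly_eval_add poly_eval_add alg_add)

lemma CEnd_0: "0 \<in> CEnd scal del"
  by (simp add: CEnd_iff_poly_eval)

lemma leibniz_0: "leibniz 0 0"
  by (simp add: leibniz_iff_poly_eval)

lemma CEnd_conf_act: "\<phi> \<in> CEnd scal del \<Longrightarrow> conf_act d act a \<phi> \<in> CEnd scal del"
proof (induction a arbitrary: \<phi>)
  case (pCons a p)
  then show ?case
    by (subst conf_act_pCons) (intro CEnd_add CEnd_conf_act_const CEnd_del pCons.IH pCons.prems)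
qed (simp add: conf_act_0 CEnd_0)

lemma leibniz_conf_act:
  "leibniz \<phi> \<sigma> \<Longrightarrow> leibniz (conf_act d act a \<phi>) (conf_act d (regular_act d) a \<sigma>)"
proof (induction a arbitrary: \<phi> \<sigma>)
  case (pCons a p)
  then show ?case
    by (subst conf_act_pCons, subst R_conf_act_pCons)
      (intro leibniz_add leibniz_conf_act_const leibniz_del pCons.IH pCons.prems)
qed (simp add: conf_act_0 R_conf_act_0 leibniz_0)

text \<open>\<open>\<chi>\<close> is the value at \<open>\<lambda> = l\<close> of \<open>[\<phi>\<^sub>\<lambda> \<psi>]\<close>.\<close>

lemma CEnd_commutator:
  assumes "\<phi> \<in> CEnd scal del" "\<psi> \<in> CEnd scal del"
    and "\<And>m v. poly_eval scal m (\<chi> v) =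
      poly_eval scal l (\<phi> (poly_eval scal (m - l) (\<psi> v)))
      - poly_eval scal (m - l) (\<psi> (poly_eval scal l (\<phi> v)))"
  shows "\<chi> \<in> CEnd scal del"
proof -
  note diff = additive.diff[OF CEnd_additive[OF assms(1)]] M.poly_eval_diff
  show ?thesis
    using assms(1,2) unfolding CEnd_iff_poly_eval assms(3)
    by (auto simp: M.scale_right_diff_distrib M.scale_left_diff_distrib del_diff diff algebra_simps)
qed

text \<open>As for ordinary derivations, the mixed terms, in which one map acts on \<open>a\<close>
  and the other on \<open>u\<close>, occur in both compositions and cancel.\<close>

lemma leibniz_commutator:
  assumes "leibniz \<phi> \<sigma>" "leibniz \<psi> \<tau>" "\<phi> \<in> CEnd scal del" "\<psi> \<in> CEnd scal del"
    and "\<And>m v. poly_eval scal m (\<chi> v) =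
      poly_eval scal l (\<phi> (poly_eval scal (m - l) (\<psi> v)))
      - poly_eval scal (m - l) (\<psi> (poly_eval scal l (\<phi> v)))"
    and "\<And>m a. poly_eval scale m (\<rho> a) =
      poly_eval scale l (\<sigma> (poly_eval scale (m - l) (\<tau> a)))
      - poly_eval scale (m - l) (\<tau> (poly_eval scale l (\<sigma> a)))"
  shows "leibniz \<chi> \<rho>"
  using assms(1-4) unfolding leibniz_iff_poly_eval CEnd_iff_poly_eval assms(5,6)
  by (simp add: alg_diff alg_add)

text \<open>Where \<phi>_s hits a coefficient of \<open>p\<close>, the substitution r+\<partial>
  stays. Where it hits the scalar (r+\<partial>)^i a, the rule \<sigma>_s \<partial> =
  (s+\<partial>) \<sigma>_s moves \<sigma>_s inside and changes the substitution to
  r+s+\<partial>.\<close>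

lemma poly_eval_subst_act:
  assumes "leibniz \<phi> \<sigma>" "\<phi> \<in> CEnd scal del" "\<sigma> \<in> CEnd scale d"
  shows "poly_eval scal s (\<phi> (subst_act r a p)) =
    subst_act (r + s) (poly_eval scale s (\<sigma> a)) p
    + subst_act r a (map_poly (\<lambda>w. poly_eval scal s (\<phi> w)) p)"
proof (induction p arbitrary: a)
  case 0
  then show ?case
    by (simp add: additive.zero[OF CEnd_additive[OF assms(2)]])
next
  case (pCons w p)
  have 0: "poly_eval scal s (\<phi> 0) = 0"
    by (simp add: additive.zero[OF CEnd_additive[OF assms(2)]])
  have "poly_eval scale s (\<sigma> (scale r a + d a)) =
      scale (r + s) (poly_eval scale s (\<sigma> a)) + d (poly_eval scale s (\<sigma> a))"
    using assms(3) by (simp add: R_CEnd_iff_poly_eval scale_left_distrib)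
  then show ?case
    using assms(1,2)
    by (simp add: leibniz_iff_poly_eval CEnd_iff_poly_eval subst_act_pCons pCons map_poly_pCons 0)
qed

text \<open>Formally p(x) = q(x-s), and x may be replaced by t+\<partial> as well as by a
  scalar.\<close>

lemma subst_act_shift:
  assumes "\<And>t. poly_eval scal t p = poly_eval scal (t - s) q"
  shows "subst_act t a p = subst_act (t - s) a q"
proof -
  \<comment> \<open>A polynomial is determined by its values, so it is enough to exhibit one with
    these values that also has the substitution property.\<close>
  have "\<exists>p. (\<forall>t. poly_eval scal t p = poly_eval scal (t - s) q) \<and>
      (\<forall>t a. subst_act t a p = subst_act (t - s) a q)"
  proof (induction q)
    case 0
    show ?case
      by (rule exI[of _ 0]) simp
  next
    case (pCons c q)
    then obtain p where p: "\<And>t. poly_eval scal t p = poly_eval scal (t - s) q"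
        "\<And>t a. subst_act t a p = subst_act (t - s) a q"
      by blast
    \<comment> \<open>Horner step in the shifted variable: this is c + (x-s)p(x).\<close>
    let ?p = "pCons c p - map_poly (scal s) p"
    have "poly_eval scal t ?p = poly_eval scal (t - s) (pCons c q)" for t
      by (simp add: M.poly_eval_diff M.poly_eval_pCons M.poly_eval_scale p M.scale_left_diff_distrib)
    moreover have "subst_act t a ?p = subst_act (t - s) a (pCons c q)" for t a
      by (simp add: additive.diff[OF additive_subst_act] subst_act_pCons subst_act_scal p
          scale_left_diff_distrib subst_act_add_left subst_act_scale
          additive.diff[OF additive_subst_act_left] M.scale_left_diff_distrib)
    ultimately show ?case by blast
  qed
  then show ?thesis
    using poly_eval_eqI[OF M.vector_space_axioms, of p] assms by metis
qed

section \<open>Commutators are polynomial in \<open>\<lambda>\<close>\<close>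

lemma poly_eval2_commutator:
  assumes "\<phi> \<in> CEnd scal del" "\<psi> \<in> CEnd scal del"
  shows "poly_eval2 scal l m (conf_commutator \<phi> \<psi> v) =
    poly_eval scal l (\<phi> (poly_eval scal (m - l) (\<psi> v)))
    - poly_eval scal (m - l) (\<psi> (poly_eval scal l (\<phi> v)))"
  by (rule M.poly_eval2_conf_commutator) (use assms in \<open>simp_all add: CEnd_additive CEnd_scal\<close>)

lemmas R_poly_eval2_commutator = dalg_module.poly_eval2_commutator
  [OF R.dalg_module_axioms, unfolded scalar_act_regular del_act_regular]

lemma additive_commutator:
  assumes "\<phi> \<in> CEnd scal del" "\<psi> \<in> CEnd scal del"
  shows "additive (conf_commutator \<phi> \<psi>)"
proof
  fix u v
  show "conf_commutator \<phi> \<psi> (u + v) = conf_commutator \<phi> \<psi> u + conf_commutator \<phi> \<psi> v"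
    by (rule poly_eval2_eqI[OF M.vector_space_axioms])
      (use assms in \<open>simp add: poly_eval2_commutator M.poly_eval2_add CEnd_iff_poly_eval\<close>)
qed

lemma commutator_scal:
  assumes "\<phi> \<in> CEnd scal del" "\<psi> \<in> CEnd scal del"
  shows "conf_commutator \<phi> \<psi> (scal c v) = map_poly (map_poly (scal c)) (conf_commutator \<phi> \<psi> v)"
  by (rule poly_eval2_eqI[OF M.vector_space_axioms],
      subst M.poly_eval2_map_poly[OF M.vector_space_axioms M.additive_scale])
    (use assms in \<open>simp_all add: poly_eval2_commutator CEnd_iff_poly_eval mult.commute
      M.scale_right_diff_distrib\<close>)

text \<open>The factor l from \<phi> and the factor m-l from \<psi> add up to m, so \<partial> acts
  through \<mu>+\<partial> alone and leaves the \<lambda>-degree unchanged.\<close>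

lemma commutator_del:
  assumes "\<phi> \<in> CEnd scal del" "\<psi> \<in> CEnd scal del"
  shows "conf_commutator \<phi> \<psi> (del v) = map_poly (lam_plus del) (conf_commutator \<phi> \<psi> v)"
proof (rule poly_eval2_eqI[OF M.vector_space_axioms])
  show "poly_eval2 scal l m (conf_commutator \<phi> \<psi> (del v)) =
      poly_eval2 scal l m (map_poly (lam_plus del) (conf_commutator \<phi> \<psi> v))" for l m
    using assms
    by (simp add: poly_eval2_commutator M.poly_eval2_lam_plus[OF additive_del del_scal]
        CEnd_iff_poly_eval[of \<phi>] CEnd_iff_poly_eval[of \<psi>] M.scale_right_diff_distrib
        M.scale_left_diff_distrib del_diff additive.diff[OF CEnd_additive[OF assms(1)]]
        M.poly_eval_diff algebra_simps)
qed

text \<open>The operations on the right act inside each coefficient of a power of \<lambda>; this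
  form is what the degree bounds need.\<close>

lemma commutator_alg:
  assumes "\<phi> \<in> CEnd scal del" "\<psi> \<in> CEnd scal del" "\<sigma> \<in> CEnd scale d" "\<tau> \<in> CEnd scale d"
    "leibniz \<phi> \<sigma>" "leibniz \<psi> \<tau>"
  shows "conf_commutator \<phi> \<psi> (alg a v) =
    map_poly (map_poly (alg a)) (conf_commutator \<phi> \<psi> v)
    + map_poly (map_poly (\<lambda>c. alg c v)) (conf_commutator \<sigma> \<tau> a)"
proof (rule poly_eval2_eqI[OF M.vector_space_axioms])
  show "poly_eval2 scal l m (conf_commutator \<phi> \<psi> (alg a v)) =
    poly_eval2 scal l m (map_poly (map_poly (alg a)) (conf_commutator \<phi> \<psi> v)
      + map_poly (map_poly (\<lambda>c. alg c v)) (conf_commutator \<sigma> \<tau> a))" for l m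
    unfolding M.poly_eval2_add M.poly_eval2_map_poly[OF M.vector_space_axioms additive_alg alg_scal]
      poly_eval2_map_poly[OF M.vector_space_axioms additive_alg_left alg_scale]
      poly_eval2_commutator[OF assms(1,2)] R_poly_eval2_commutator[OF assms(3,4)]
    using assms(1,2,5,6)
    by (simp add: leibniz_iff_poly_eval CEnd_iff_poly_eval alg_diff alg_add)
qed

lemmas R_additive_commutator = dalg_module.additive_commutator
    [OF R.dalg_module_axioms, unfolded scalar_act_regular del_act_regular]
  and R_commutator_scal = dalg_module.commutator_scal
    [OF R.dalg_module_axioms, unfolded scalar_act_regular del_act_regular]
  and R_commutator_del = dalg_module.commutator_del
    [OF R.dalg_module_axioms, unfolded scalar_act_regular del_act_regular]
  and R_commutator_alg = dalg_module.commutator_alg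
    [OF R.dalg_module_axioms, unfolded scalar_act_regular del_act_regular alg_act_regular]
  and R_leibniz_def = dalg_module.leibniz_def
    [OF R.dalg_module_axioms, unfolded alg_act_regular]

text \<open>A conformal derivation is its own anchor for M = A, so results on Leibniz pairs apply to
  (\<sigma>,\<sigma>).\<close>

lemma CDer_iff:
  "\<sigma> \<in> CDer scale d \<longleftrightarrow> \<sigma> \<in> CEnd scale d \<and> dalg_module.leibniz (regular_act d) \<sigma> \<sigma>"
proof -
  have "\<sigma> (a * b) = smult b (\<sigma> a) + smult a (\<sigma> b) \<longleftrightarrow>
      \<sigma> (a * b) = map_poly ((*) a) (\<sigma> b) + map_poly (\<lambda>c. c * b) (\<sigma> a)" for a b
    by (simp add: smult_conv_map_poly add.commute mult.commute[of _ b])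
  then show ?thesis
    by (simp add: CDer_def R_leibniz_def)
qed

lemma gauge_iff:
  "(\<phi>, \<sigma>) \<in> gauge scale d act \<longleftrightarrow>
    \<phi> \<in> CEnd scal del \<and> \<sigma> \<in> CDer scale d \<and> leibniz \<phi> \<sigma>"
proof (cases "\<phi> \<in> CEnd scal del \<and> \<sigma> \<in> CDer scale d")
  case True
  then have \<phi>: "additive \<phi>" "\<And>u. \<phi> (del u) = lam_plus del (\<phi> u)" and \<sigma>: "\<sigma> 0 = 0"
    using dalg_module.CEnd_additive[OF R.dalg_module_axioms, unfolded scalar_act_regular del_act_regular]
    by (auto simp: CEnd_additive CDer_def CEnd_def additive.zero)
  have "leibniz \<phi> \<sigma>"
    if "\<forall>a u. \<phi> (act a u) = symbol_act act \<sigma> a u + shifted_act act a (\<phi> u)"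
    unfolding leibniz_def
  proof (intro allI)
    fix a u
    show "\<phi> (alg a u) = map_poly (alg a) (\<phi> u) + map_poly (\<lambda>c. alg c u) (\<sigma> a)"
      using that[rule_format, of "[:a:]" u]
      by (simp add: alg_act_def[of act a u] shifted_act_pCons shifted_act_0
          symbol_act_pCons[where \<sigma> = \<sigma>, OF \<sigma>] symbol_act_0[where \<sigma> = \<sigma>, OF \<sigma>])
  qed
  moreover have "\<phi> (act a u) = symbol_act act \<sigma> a u + shifted_act act a (\<phi> u)"
    if "leibniz \<phi> \<sigma>" for a u
    using leibniz_act[of UNIV \<phi> \<sigma> u a] that \<phi> \<sigma>
    by (simp add: leibniz_def additive.add add.commute)
  ultimately show ?thesis
    using True by (auto simp: gauge_def)
qed (auto simp: gauge_def)

text \<open>The bound concerns the outer variable \<lambda> only. The degree in \<mu> may grow under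
  \<open>d\<close>, which is harmless since the bracket coefficients are maps into A[\<mu>].\<close>

lemma degree_commutator_bounded_CDer:
  assumes "fg_differential_algebra scale d" "\<sigma> \<in> CDer scale d" "\<tau> \<in> CDer scale d"
  obtains N where "\<And>a. degree (conf_commutator \<sigma> \<tau> a) \<le> N"
proof -
  let ?C = "conf_commutator \<sigma> \<tau>"
  have \<sigma>\<tau>: "\<sigma> \<in> CEnd scale d" "\<tau> \<in> CEnd scale d"
    using assms(2,3) by (auto simp: CDer_def)
  have mult: "?C (a * b) = map_poly (map_poly ((*) a)) (?C b) + map_poly (map_poly (\<lambda>c. c * b)) (?C a)"
    for a b
    using R_commutator_alg[OF \<sigma>\<tau> \<sigma>\<tau>] assms(2,3) by (simp add: CDer_iff)
  obtain S where S: "finite S" "dalg_generated scale d S = UNIV"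
    using assms(1) by (auto simp: fg_differential_algebra_def)
  obtain N where N: "\<And>a. a \<in> S \<Longrightarrow> degree (?C a) \<le> N"
    using finite_imageI[OF S(1), of "\<lambda>a. degree (?C a)"] by (auto simp: finite_nat_set_iff_bounded_le)
  have "degree (?C a) \<le> N" if "a \<in> dalg_generated scale d S" for a
    using that
  proof induction
    case one
    have "map_poly (map_poly f) q = q" if "\<And>x. f x = x" for f and q :: "'a poly poly"
      by (simp add: poly_eq_iff coeff_map_poly that)
    \<comment> \<open>At a = b = 1 both summands of \<open>mult\<close> equal \<open>?C 1\<close>,
      so \<open>?C 1\<close> is twice itself.\<close>
    then have "?C 1 = 0"
      using mult[of 1 1] by simp
    then show ?case by simp
  next
    case (mult a b)
    then show ?case
      unfolding \<open>?C (a * b) = _\<close>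
      by (intro degree_add_le order.trans[OF degree_map_poly_le]) simp_all
  next
    case (scale a c)
    then show ?case
      unfolding R_commutator_scal[OF \<sigma>\<tau>] by (intro order.trans[OF degree_map_poly_le]) simp_all
  next
    case (add a b)
    then show ?case
      unfolding additive.add[OF R_additive_commutator[OF \<sigma>\<tau>]] by (intro degree_add_le)
  next
    case (deriv a)
    then show ?case
      unfolding R_commutator_del[OF \<sigma>\<tau>]
      by (intro order.trans[OF degree_map_poly_le]) (simp_all add: lam_plus_def)
  qed (rule N)
  then show thesis
    using that S by blast
qed

lemma degree_commutator_bounded:
  assumes "fg_differential_algebra scale d" "fg_dop_module d UNIV act"
    and "(\<phi>, \<sigma>) \<in> gauge scale d act" "(\<psi>, \<tau>) \<in> gauge scale d act"
  obtains N where "\<And>v. degree (conf_commutator \<phi> \<psi> v) \<le> N"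
proof -
  let ?C = "conf_commutator \<phi> \<psi>"
  have \<phi>\<psi>: "\<phi> \<in> CEnd scal del" "\<psi> \<in> CEnd scal del"
    and \<sigma>\<tau>: "\<sigma> \<in> CDer scale d" "\<tau> \<in> CDer scale d" "\<sigma> \<in> CEnd scale d" "\<tau> \<in> CEnd scale d"
    and leib: "leibniz \<phi> \<sigma>" "leibniz \<psi> \<tau>"
    using assms(3,4) by (auto simp: gauge_iff CDer_def)
  note add = additive.add[OF additive_commutator[OF \<phi>\<psi>]]
    and zero = additive.zero[OF additive_commutator[OF \<phi>\<psi>]]
  obtain N where N: "\<And>a. degree (conf_commutator \<sigma> \<tau> a) \<le> N"
    using degree_commutator_bounded_CDer[OF assms(1) \<sigma>\<tau>(1,2)] by blast
  obtain S where S: "finite S" "\<And>u. \<exists>a. u = (\<Sum>s\<in>S. act (a s) s)"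
    using assms(2) by (auto simp: fg_dop_module_def)
  obtain K where K: "\<And>s. s \<in> S \<Longrightarrow> degree (?C s) \<le> K"
    using finite_imageI[OF S(1), of "\<lambda>a. degree (?C a)"] by (auto simp: finite_nat_set_iff_bounded_le)
  \<comment> \<open>Bounding the generators of \<open>M\<close> is not enough: the Leibniz rule adds
    the commutator of the anchors at an arbitrary element of \<open>A\<close>, which
    \<open>N\<close> controls.\<close>
  let ?L = "max N K"
  have act: "degree (?C (act a u)) \<le> ?L" if "degree (?C u) \<le> ?L" for a u
    using that
  proof (induction a arbitrary: u)
    case 0
    then show ?case by (simp add: act_0 zero)
  next
    case (pCons a p)
    have "degree (?C (alg a u)) \<le> ?L"
      unfolding commutator_alg[OF \<phi>\<psi> \<sigma>\<tau>(3,4) leib]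
      by (intro degree_add_le order.trans[OF degree_map_poly_le])
        (use N[of a] pCons.prems in \<open>simp_all add: le_max_iff_disj\<close>)
    moreover have "degree (?C (del u)) \<le> ?L"
      unfolding commutator_del[OF \<phi>\<psi>]
      by (intro order.trans[OF degree_map_poly_le]) (use pCons.prems in \<open>simp_all add: lam_plus_def\<close>)
    ultimately show ?case
      unfolding act_pCons add by (intro degree_add_le pCons.IH)
  qed
  have "degree (?C v) \<le> ?L" for v
  proof -
    obtain a where "v = (\<Sum>s\<in>S. act (a s) s)"
      using S(2) by blast
    then have "?C v = (\<Sum>s\<in>S. ?C (act (a s) s))"
      by (simp add: additive.sum[OF additive_commutator[OF \<phi>\<psi>]])
    moreover have "degree (?C (act (a s) s)) \<le> ?L" if "s \<in> S" for s
      by (rule act) (use K[OF that] in simp)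
    ultimately show ?thesis
      by (simp add: degree_sum_le S(1) del: max.bounded_iff)
  qed
  then show thesis by (rule that)
qed

end

section \<open>Algebroids of conformal maps\<close>

text \<open>Both \<open>\<G>(A,M)\<close>, through either projection \<open>\<Phi>\<close>, and \<open>CDer(A)\<close>, with \<open>\<Phi>\<close> the
  identity, are of this form.\<close>

locale conformal_rep = dalg_module scale d act + E: dalg_module scale d eact
  for scale :: "'k::field_char_0 \<Rightarrow> 'a::{comm_ring,comm_monoid_mult} \<Rightarrow> 'a"
    and d :: "'a \<Rightarrow> 'a"
    and act :: "'a poly \<Rightarrow> 'm::ab_group_add \<Rightarrow> 'm"
    and eact :: "'a poly \<Rightarrow> 'e::ab_group_add \<Rightarrow> 'e" +
  fixes G :: "'e set"
    and br :: "'e \<Rightarrow> 'e \<Rightarrow> 'e poly"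
    and \<Phi> :: "'e \<Rightarrow> 'm \<Rightarrow> 'm poly"
    and \<Theta> :: "'e \<Rightarrow> 'a \<Rightarrow> 'a poly"
  assumes rep_add: "\<Phi> (X + Y) = \<Phi> X + \<Phi> Y"
    and rep_act: "\<Phi> (eact a X) = conf_act d act a (\<Phi> X)"
    and rep_CEnd: "X \<in> G \<Longrightarrow> \<Phi> X \<in> CEnd scal del"
    and anchor_CEnd: "X \<in> G \<Longrightarrow> \<Theta> X \<in> CEnd scale d"
    and rep_leibniz: "X \<in> G \<Longrightarrow> leibniz (\<Phi> X) (\<Theta> X)"
    and rep_br: "X \<in> G \<Longrightarrow> Y \<in> G \<Longrightarrow> \<Phi> (coeff (br X Y) i) v = coeff (conf_commutator (\<Phi> X) (\<Phi> Y) v) i"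
begin

definition val :: "'k \<Rightarrow> 'e \<Rightarrow> 'm \<Rightarrow> 'm" where
  "val t X v = poly_eval scal t (\<Phi> X v)"

lemma additive_val: "additive (\<lambda>X. val t X v)"
  by unfold_locales (simp add: val_def rep_add M.poly_eval_add)

lemmas val_add = additive.add[OF additive_val]
  and val_diff = additive.diff[OF additive_val]
  and val_minus = additive.minus[OF additive_val]

lemma val_alg: "val t (E.alg a X) v = subst_act t a (\<Phi> X v)"
  by (simp add: val_def alg_act_def[of eact] rep_act poly_eval_conf_act)

text \<open>Scalars act through constants killed by \<open>d\<close>, so no derivative survives in
  the substitution.\<close>

lemma val_scal: "val t (E.scal c X) v = scal c (val t X v)"
  by (simp add: E.scal_conv_alg val_alg subst_act_scale subst_act_one) (simp add: val_def)

lemma val_del: "val t (E.del X) v = - scal t (val t X v)"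
  using del_act_conf_act[of "\<Phi> X"]
  by (simp add: val_def del_act_def[of eact] del_act_def[of "conf_act d act"] rep_act
      M.poly_eval_minus M.poly_eval_pCons)

lemma
  assumes "X \<in> G"
  shows val_add_right: "val t X (u + v) = val t X u + val t X v"
    and val_scal_right: "val t X (scal c u) = scal c (val t X u)"
    and val_minus_right: "val t X (- u) = - val t X u"
    and val_diff_right: "val t X (u - v) = val t X u - val t X v"
  using rep_CEnd[OF assms] CEnd_additive[OF rep_CEnd[OF assms]]
  by (simp_all add: CEnd_iff_poly_eval val_def additive.minus additive.diff M.poly_eval_minus
      M.poly_eval_diff)

lemma val_poly_expand: "val t (poly_expand g p) v = poly_expand (\<lambda>i c. val t (g i c) v) p"
  by (rule poly_expand_additive[OF additive_val])

lemma val_poly_eval: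
  "val m (poly_eval E.scal l p) v = poly_expand (\<lambda>i c. scal (l ^ i) (val m c v)) p"
  by (rule E.M.poly_eval_linear[OF additive_val val_scal])

lemma val_br:
  assumes "X \<in> G" "Y \<in> G"
  shows "val m (poly_eval E.scal l (br X Y)) v = val l X (val (m - l) Y v) - val (m - l) Y (val l X v)"
proof -
  have add: "additive (\<lambda>Z. \<Phi> Z v)"
    by unfold_locales (simp add: rep_add)
  have scal: "\<Phi> (E.scal c Z) v = map_poly (scal c) (\<Phi> Z v)" for c Z
    by (rule poly_eval_eqI[OF M.vector_space_axioms])
      (use val_scal in \<open>simp add: val_def M.poly_eval_scale\<close>)
  have "map_poly (\<lambda>Z. \<Phi> Z v) (br X Y) = conf_commutator (\<Phi> X) (\<Phi> Y) v"
    by (simp add: poly_eq_iff coeff_map_poly additive.zero[OF add] rep_br assms)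
  then have "poly_eval2 scal l m (conf_commutator (\<Phi> X) (\<Phi> Y) v) = val m (poly_eval E.scal l (br X Y)) v"
    using E.M.poly_eval_map_poly[OF vector_space_poly[OF M.vector_space_axioms] add scal, of l "br X Y"]
    by (simp add: poly_eval2_def val_def)
  then show ?thesis
    by (simp add: poly_eval2_commutator rep_CEnd assms val_def)
qed

lemma br_value_CEnd:
  "X \<in> G \<Longrightarrow> Y \<in> G \<Longrightarrow> \<Phi> (poly_eval E.scal l (br X Y)) \<in> CEnd scal del"
  by (rule CEnd_commutator[OF rep_CEnd rep_CEnd]) (use val_br in \<open>simp_all add: val_def\<close>)

lemma val_br_act:
  assumes "X \<in> G" "Y \<in> G" "E.alg a Y \<in> G"
  shows "val m (poly_eval E.scal l (br X (E.alg a Y))) v =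
    val m (poly_eval E.scal l (map_poly (E.alg a) (br X Y) + map_poly (\<lambda>c. E.alg c Y) (\<Theta> X a))) v"
proof -
  let ?Z = "poly_eval E.scal l (br X Y)" and ?\<phi> = "\<lambda>w. val l X w"
  \<comment> \<open>As a polynomial in t, \<open>?q\<close> has as value the commutator of X_l and
    Y_t applied to v. The whole polynomial of [X_l Y] is therefore \<open>?q\<close> shifted by l,
    which is more than its value at m and is what the action of \<open>a\<close> requires.\<close>
  let ?q = "map_poly ?\<phi> (\<Phi> Y v) - \<Phi> Y (?\<phi> v)"
  have add: "additive ?\<phi>"
    by unfold_locales (simp add: val_add_right assms)
  have "poly_eval scal t (\<Phi> ?Z v) = poly_eval scal (t - l) ?q" for t
    using val_br[OF assms(1,2), of t l v] val_scal_right[OF assms(1)]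
    by (simp add: M.poly_eval_diff M.poly_eval_map_poly[OF M.vector_space_axioms add])
      (simp add: val_def)
  then have "subst_act m a (\<Phi> ?Z v) = subst_act (m - l) a ?q"
    by (rule subst_act_shift)
  then show ?thesis
    using poly_eval_subst_act[OF rep_leibniz rep_CEnd anchor_CEnd, OF assms(1,1,1), of l "m - l" a "\<Phi> Y v"]
    by (simp add: val_br assms E.M.poly_eval_add E.poly_eval_alg E.poly_eval_alg_left val_add val_alg
        additive.diff[OF additive_subst_act] val_def[symmetric])
qed

text \<open>On values at m, \<partial> acts as -m, so replacing \<lambda> by -\<lambda>-\<partial>
  amounts to evaluating at m-l. What remains is antisymmetry of the commutator of X_(m-l) and
  Y_l.\<close>

lemma val_skew:
  assumes "X \<in> G" "Y \<in> G"
  shows "val m (poly_eval E.scal l (br Y X)) v =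
    val m (poly_eval E.scal l (- adj_subst E.del (br X Y))) v"
proof -
  have "poly_eval E.scal l (((\<lambda>q. - lam_plus E.del q) ^^ i) [:c:]) =
      ((\<lambda>Z. - (E.scal l Z + E.del Z)) ^^ i) c" for i c
    using funpow_intertwine[of "poly_eval E.scal l" "\<lambda>q. - lam_plus E.del q"
        "\<lambda>Z. - (E.scal l Z + E.del Z)" i "[:c:]"]
    by (simp add: E.M.poly_eval_minus E.poly_eval_lam_plus_del)
  moreover have "val m (((\<lambda>Z. - (E.scal l Z + E.del Z)) ^^ i) c) v = scal ((m - l) ^ i) (val m c v)" for i c
    using funpow_intertwine[of "\<lambda>Z. val m Z v" "\<lambda>Z. - (E.scal l Z + E.del Z)" "scal (m - l)" i c]
    by (simp add: val_minus val_diff val_scal val_del M.scale_left_diff_distrib M.funpow_scale del: funpow.simps)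
  ultimately have "val m (poly_eval E.scal l (adj_subst E.del (br X Y))) v =
      val m (poly_eval E.scal (m - l) (br X Y)) v"
    by (simp add: adj_subst_def E.M.poly_eval_poly_expand val_poly_expand val_poly_eval)
  then show ?thesis
    by (simp add: E.M.poly_eval_minus val_minus val_br assms)
qed

text \<open>In a nested bracket the inner one, \<open>q\<close>, enters coefficient by coefficient.
  \<open>val\<close> is linear in the element, so after evaluation the coefficients reassemble into
  the operator of q(m), with no appeal to linearity of \<open>br\<close>.\<close>

lemma val_br_poly_eval_right:
  assumes "X \<in> G" "\<And>i. coeff q i \<in> G"
  shows "val n (poly_expand (\<lambda>j c. E.scal (m ^ j) (poly_eval E.scal l (br X c))) q) v =
    val l X (val (n - l) (poly_eval E.scal m q) v) - val (n - l) (poly_eval E.scal m q) (val l X v)"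
proof -
  let ?f = "\<lambda>c. val l X (val (n - l) c v) - val (n - l) c (val l X v)"
  have "?f (poly_eval E.scal m q) = poly_expand (\<lambda>j c. scal (m ^ j) (?f c)) q"
  proof (rule E.M.poly_eval_linear)
    show "additive ?f"
      by unfold_locales (simp add: val_add val_add_right assms)
  qed (simp add: val_scal val_scal_right assms M.scale_right_diff_distrib)
  also have "\<dots> = poly_expand (\<lambda>j c. scal (m ^ j) (val n (poly_eval E.scal l (br X c)) v)) q"
    by (rule poly_expand_cong) (simp add: val_br assms)
  finally show ?thesis
    by (simp add: val_poly_expand val_scal)
qed

lemma val_br_poly_eval_left:
  assumes "Y \<in> G" "\<And>i. coeff q i \<in> G"
  shows "val n (poly_expand (\<lambda>j c. E.scal (m ^ j) (poly_eval E.scal l (br c Y))) q) v =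
    val l (poly_eval E.scal m q) (val (n - l) Y v) - val (n - l) Y (val l (poly_eval E.scal m q) v)"
proof -
  let ?f = "\<lambda>c. val l c (val (n - l) Y v) - val (n - l) Y (val l c v)"
  have "?f (poly_eval E.scal m q) = poly_expand (\<lambda>j c. scal (m ^ j) (?f c)) q"
  proof (rule E.M.poly_eval_linear)
    show "additive ?f"
      by unfold_locales (simp add: val_add val_add_right assms)
  qed (simp add: val_scal val_scal_right assms M.scale_right_diff_distrib)
  also have "\<dots> = poly_expand (\<lambda>j c. scal (m ^ j) (val n (poly_eval E.scal l (br c Y)) v)) q"
    by (rule poly_expand_cong) (simp add: val_br assms)
  finally show ?thesis
    by (simp add: val_poly_expand val_scal)
qed

text \<open>With all brackets evaluated, this is the Jacobi identity for commutators of the operators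
  \<open>X\<^sub>l\<close>, \<open>Y\<^sub>m\<close> and \<open>Z\<^bsub>n-l-m\<^esub>\<close>.\<close>

lemma val_jacobi:
  assumes "X \<in> G" "Y \<in> G" "Z \<in> G"
    and closed: "\<And>X Y i. X \<in> G \<Longrightarrow> Y \<in> G \<Longrightarrow> coeff (br X Y) i \<in> G"
  shows "val n (poly_expand (\<lambda>j c. E.scal (m ^ j) (poly_eval E.scal l (br X c))) (br Y Z)
      - poly_expand (\<lambda>j c. E.scal (l ^ j) (poly_eval E.scal m (br Y c))) (br X Z)) v =
    val n (poly_expand (\<lambda>j c. E.scal (l ^ j) (poly_eval E.scal (l + m) (br c Z))) (br X Y)) v"
  by (simp add: val_diff val_br_poly_eval_right val_br_poly_eval_left assms closed val_br
      val_diff_right algebra_simps)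

end

text \<open>Abstracts what G(A,M) and CDer(A) share: elements faithfully encoded by the pair
  (\<Phi>, \<Theta>), on which the action and the bracket are the concrete ones. Only the bracket
  conditions are restricted to \<open>G\<close>, since polynomiality of the bracket is known only
  there.\<close>

locale gauge_model = dalg_module scale d act
  for scale :: "'k::field_char_0 \<Rightarrow> 'a::{comm_ring,comm_monoid_mult} \<Rightarrow> 'a"
    and d :: "'a \<Rightarrow> 'a"
    and act :: "'a poly \<Rightarrow> 'm::ab_group_add \<Rightarrow> 'm" +
  fixes eact :: "'a poly \<Rightarrow> 'e::ab_group_add \<Rightarrow> 'e"
    and G :: "'e set"
    and br :: "'e \<Rightarrow> 'e \<Rightarrow> 'e poly"
    and \<Phi> :: "'e \<Rightarrow> 'm \<Rightarrow> 'm poly"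
    and \<Theta> :: "'e \<Rightarrow> 'a \<Rightarrow> 'a poly"
  assumes carrier: "X \<in> G \<longleftrightarrow> (\<Phi> X, \<Theta> X) \<in> gauge scale d act"
    and inj: "\<Phi> X = \<Phi> Y \<Longrightarrow> \<Theta> X = \<Theta> Y \<Longrightarrow> X = Y"
    and rep_add: "\<Phi> (X + Y) = \<Phi> X + \<Phi> Y"
    and anchor_add: "\<Theta> (X + Y) = \<Theta> X + \<Theta> Y"
    and rep_act: "\<Phi> (eact a X) = conf_act d act a (\<Phi> X)"
    and anchor_act: "\<Theta> (eact a X) = conf_act d (regular_act d) a (\<Theta> X)"
    and rep_br: "X \<in> G \<Longrightarrow> Y \<in> G \<Longrightarrow>
      \<Phi> (coeff (br X Y) i) v = coeff (conf_commutator (\<Phi> X) (\<Phi> Y) v) i"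
    and anchor_br: "X \<in> G \<Longrightarrow> Y \<in> G \<Longrightarrow>
      \<Theta> (coeff (br X Y) i) b = coeff (conf_commutator (\<Theta> X) (\<Theta> Y) b) i"
begin

lemma carrierD:
  assumes "X \<in> G"
  shows "\<Phi> X \<in> CEnd scal del" "\<Theta> X \<in> CEnd scale d" "\<Theta> X \<in> CDer scale d" "leibniz (\<Phi> X) (\<Theta> X)"
    "dalg_module.leibniz (regular_act d) (\<Theta> X) (\<Theta> X)"
  using assms by (auto simp: carrier gauge_iff CDer_iff)

lemma carrierI:
  "\<Phi> X \<in> CEnd scal del \<Longrightarrow> \<Theta> X \<in> CEnd scale d \<Longrightarrow> leibniz (\<Phi> X) (\<Theta> X) \<Longrightarrow>
    dalg_module.leibniz (regular_act d) (\<Theta> X) (\<Theta> X) \<Longrightarrow> X \<in> G"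
  by (auto simp: carrier gauge_iff CDer_iff)

sublocale E: dalg_module scale d eact
proof -
  interpret C: dalg_module scale d "conf_act d act"
    by (rule dalg_module_conf_act)
  interpret CR: dalg_module scale d "conf_act d (regular_act d)"
    by (rule dalg_module.dalg_module_conf_act[OF R.dalg_module_axioms])
  \<comment> \<open>The laws hold in each component for all maps, and \<open>inj\<close> transports
    them to the abstract elements.\<close>
  have "dop_module d UNIV eact"
    by unfold_locales
      (auto intro!: inj simp: rep_add anchor_add rep_act anchor_act C.act_add_right C.act_add_left
        C.act_mult C.act_one CR.act_add_right CR.act_add_left CR.act_mult CR.act_one)
  then show "dalg_module scale d eact"
    by (simp add: dalg_module_def differential_algebra_axioms)
qed

sublocale F: conformal_rep scale d act eact G br \<Phi> \<Theta>
  by unfold_locales (simp_all add: rep_add rep_act rep_br carrierD)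

sublocale T: conformal_rep scale d "regular_act d" eact G br \<Theta> \<Theta>
  by unfold_locales
    (simp_all add: anchor_add anchor_act anchor_br carrierD scalar_act_regular del_act_regular)

lemma eval_eqI:
  assumes "\<And>t v. F.val t X v = F.val t Y v" "\<And>t a. T.val t X a = T.val t Y a"
  shows "X = Y"
proof (rule inj)
  show "\<Phi> X = \<Phi> Y"
    by (rule conf_map_eqI) (use assms(1) in \<open>simp add: F.val_def\<close>)
  show "\<Theta> X = \<Theta> Y"
    by (rule dalg_module.conf_map_eqI[OF R.dalg_module_axioms])
      (use assms(2) in \<open>simp add: T.val_def\<close>)
qed

text \<open>Each bracket identity is tested at scalars l and m, through the operators on
  \<open>M\<close> (prefix \<open>F\<close>) and on \<open>A\<close> (prefix
  \<open>T\<close>).\<close>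

lemma poly_eqI:
  assumes "\<And>l m v. F.val m (poly_eval E.scal l p) v = F.val m (poly_eval E.scal l q) v"
    "\<And>l m a. T.val m (poly_eval E.scal l p) a = T.val m (poly_eval E.scal l q) a"
  shows "p = q"
  by (intro poly_eval_eqI[OF E.M.vector_space_axioms] eval_eqI assms)

section \<open>Closure of the carrier under the module operations and the bracket\<close>

lemma add_closed: "X \<in> G \<Longrightarrow> Y \<in> G \<Longrightarrow> X + Y \<in> G"
  by (rule carrierI) (simp_all only: rep_add anchor_add CEnd_add leibniz_add carrierD
      dalg_module.leibniz_add[OF R.dalg_module_axioms]
      dalg_module.CEnd_add[OF R.dalg_module_axioms, unfolded scalar_act_regular del_act_regular])

lemma act_closed: "X \<in> G \<Longrightarrow> eact a X \<in> G"
  by (rule carrierI) (simp_all only: rep_act anchor_act CEnd_conf_act leibniz_conf_act carrierD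
      dalg_module.leibniz_conf_act[OF R.dalg_module_axioms]
      dalg_module.CEnd_conf_act[OF R.dalg_module_axioms, unfolded scalar_act_regular del_act_regular])

lemma zero_closed: "0 \<in> G"
proof (rule carrierI)
  have "\<Phi> 0 = 0" "\<Theta> 0 = 0"
    using rep_add[of 0 0] anchor_add[of 0 0] by simp_all
  then show "\<Phi> 0 \<in> CEnd scal del" "\<Theta> 0 \<in> CEnd scale d" "leibniz (\<Phi> 0) (\<Theta> 0)"
    "dalg_module.leibniz (regular_act d) (\<Theta> 0) (\<Theta> 0)"
    using dalg_module.CEnd_0[OF R.dalg_module_axioms, unfolded scalar_act_regular del_act_regular]
    by (simp_all add: CEnd_0 leibniz_0 dalg_module.leibniz_0[OF R.dalg_module_axioms])
qed

lemma alg_closed: "X \<in> G \<Longrightarrow> E.alg a X \<in> G"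
  and del_closed: "X \<in> G \<Longrightarrow> E.del X \<in> G"
  and scal_closed: "X \<in> G \<Longrightarrow> E.scal c X \<in> G"
  by (simp_all add: alg_act_def del_act_def scalar_act_def act_closed)

lemma uminus_closed: "X \<in> G \<Longrightarrow> - X \<in> G"
  using scal_closed[of X "- 1"] by simp

lemma br_closed:
  assumes "X \<in> G" "Y \<in> G"
  shows "coeff (br X Y) i \<in> G"
\<comment> \<open>The values of the bracket at scalars l are commutators, for which membership is
  clear; the coefficients inherit it because \<open>G\<close> is a subspace.\<close>
proof (rule poly_eval_coeff_in_subspace[OF E.M.vector_space_axioms])
  show "E.M.subspace G"
    by (auto simp: E.M.subspace_def zero_closed add_closed scal_closed)
  show "poly_eval E.scal l (br X Y) \<in> G" for l
  proof (rule carrierI)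
    have F: "poly_eval scal m (\<Phi> (poly_eval E.scal l (br X Y)) v) =
        poly_eval scal l (\<Phi> X (poly_eval scal (m - l) (\<Phi> Y v)))
        - poly_eval scal (m - l) (\<Phi> Y (poly_eval scal l (\<Phi> X v)))" for m v
      using F.val_br[OF assms] by (simp add: F.val_def)
    have T: "poly_eval scale m (\<Theta> (poly_eval E.scal l (br X Y)) a) =
        poly_eval scale l (\<Theta> X (poly_eval scale (m - l) (\<Theta> Y a)))
        - poly_eval scale (m - l) (\<Theta> Y (poly_eval scale l (\<Theta> X a)))" for m a
      using T.val_br[OF assms] by (simp add: T.val_def scalar_act_regular)
    note D = carrierD[OF assms(1)] carrierD[OF assms(2)]
    show "\<Phi> (poly_eval E.scal l (br X Y)) \<in> CEnd scal del"
      by (rule F.br_value_CEnd[OF assms])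
    show "\<Theta> (poly_eval E.scal l (br X Y)) \<in> CEnd scale d"
      using T.br_value_CEnd[OF assms] by (simp add: scalar_act_regular del_act_regular)
    show "leibniz (\<Phi> (poly_eval E.scal l (br X Y))) (\<Theta> (poly_eval E.scal l (br X Y)))"
      by (rule leibniz_commutator[OF D(4,9,1,6) F T])
    show "dalg_module.leibniz (regular_act d)
        (\<Theta> (poly_eval E.scal l (br X Y))) (\<Theta> (poly_eval E.scal l (br X Y)))"
      by (rule dalg_module.leibniz_commutator
          [OF R.dalg_module_axioms, unfolded scalar_act_regular del_act_regular, OF D(5,10,2,7) T T])
  qed
qed

section \<open>The algebroid axioms\<close>

lemma
  assumes "u \<in> G" "v \<in> G" "w \<in> G"
  shows br_add_left: "br (u + v) w = br u w + br v w"
    and br_add_right: "br u (v + w) = br u v + br u w"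
  by (rule poly_eqI; simp add: E.M.poly_eval_add F.val_add T.val_add F.val_br T.val_br
      F.val_add_right T.val_add_right assms add_closed)+

lemmas T_val = T.val_scal[unfolded scalar_act_regular] T.val_scal_right[unfolded scalar_act_regular]
  T.val_del[unfolded scalar_act_regular]

lemma
  assumes "u \<in> G" "v \<in> G"
  shows br_scal_left: "br (E.scal c u) v = map_poly (E.scal c) (br u v)"
    and br_scal_right: "br u (E.scal c v) = map_poly (E.scal c) (br u v)"
  by (rule poly_eqI; simp add: E.M.poly_eval_scale F.val_scal T_val F.val_br T.val_br
      F.val_scal_right assms scal_closed M.scale_right_diff_distrib scale_right_diff_distrib)+

text \<open>\<partial> acts as -l on X_l, as l-m on Y_(m-l) and as -m on the value of a bracket at
  m, so l+\<partial> on the bracket agrees with \<partial> on the second argument.\<close>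

lemma
  assumes "u \<in> G" "v \<in> G"
  shows br_del_left: "br (E.del u) v = - pCons 0 (br u v)"
    and br_del_right: "br u (E.del v) = lam_plus E.del (br u v)"
  by (rule poly_eqI; simp add: E.M.poly_eval_minus E.M.poly_eval_pCons E.poly_eval_lam_plus_del
      F.val_add T.val_add F.val_minus T.val_minus F.val_scal T_val F.val_del
      F.val_br T.val_br F.val_scal_right F.val_minus_right T.val_minus_right F.val_diff_right T.val_diff_right
      assms del_closed M.scale_right_diff_distrib M.scale_left_diff_distrib
      scale_right_diff_distrib scale_left_diff_distrib)+

lemma br_skew: "u \<in> G \<Longrightarrow> v \<in> G \<Longrightarrow> br v u = - adj_subst E.del (br u v)"
  by (rule poly_eqI) (rule F.val_skew T.val_skew; assumption)+

lemma br_alg: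
  assumes "u \<in> G" "v \<in> G"
  shows "br u (E.alg a v) = map_poly (E.alg a) (br u v) + map_poly (\<lambda>c. E.alg c v) (\<Theta> u a)"
  by (rule poly_eqI) (rule F.val_br_act T.val_br_act; simp add: assms alg_closed)+

lemma br_act:
  assumes "u \<in> G" "v \<in> G"
  shows "br u (eact a v) = shifted_act eact a (br u v) + symbol_act eact (\<Theta> u) a v"
\<comment> \<open>Here \<open>br u\<close> plays the part of the conformal map, on the module of
  algebroid elements itself, with \<open>\<Theta> u\<close> as its derivation.\<close>
proof (rule E.leibniz_act[where E = G])
  show "\<Theta> u 0 = 0"
    using carrierD(2)[OF assms(1)] R.dalg_module_axioms dalg_module.CEnd_additive additive.zero
    by (metis del_act_regular scalar_act_regular)
qed (simp_all add: assms del_closed alg_closed act_closed br_add_right br_del_right br_alg)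

lemma br_jacobi:
  assumes "u \<in> G" "v \<in> G" "w \<in> G"
  shows "poly_expand (\<lambda>j c. (mult_mu ^^ j) (embed_lam (br u c))) (br v w) - map_poly (br v) (br u w)
    = poly_expand (\<lambda>k z. (mult_lam ^^ k) (at_lam_plus_mu (br z w))) (br u v)"
proof (rule poly_eval2_eqI[OF E.M.vector_space_axioms])
  fix l m
  have lam: "poly_eval2 E.scal l m ((mult_lam ^^ n) q) = E.scal (l ^ n) (poly_eval2 E.scal l m q)" for n q
    using funpow_intertwine[of "poly_eval2 E.scal l m" mult_lam "E.scal l" n q]
    by (simp add: E.M.poly_eval2_mult_lam E.M.funpow_scale)
  have mu: "poly_eval2 E.scal l m ((mult_mu ^^ n) q) = E.scal (m ^ n) (poly_eval2 E.scal l m q)" for n q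
    using funpow_intertwine[of "poly_eval2 E.scal l m" mult_mu "E.scal m" n q]
    by (simp add: E.M.poly_eval2_mult_mu E.M.funpow_scale)
  \<comment> \<open>In the second Jacobi term the powers of \<lambda> stay outside and each bracket
    with \<open>v\<close> is a polynomial in the inner variable \<mu>, so \<open>map_poly\<close>
    suffices, provided that zero is preserved.\<close>
  have "br v 0 = 0"
    using br_add_right[OF assms(2) zero_closed zero_closed] by simp
  then have second: "poly_eval2 E.scal l m (map_poly (br v) q) =
      poly_expand (\<lambda>j c. E.scal (l ^ j) (poly_eval E.scal m (br v c))) q" for q
    by (simp add: poly_eval2_def poly_eval_def[of "\<lambda>c. map_poly (E.scal c)"] poly_expand_map_poly
        E.M.poly_eval_poly_expand E.M.poly_eval_scale)
  show "poly_eval2 E.scal l m (poly_expand (\<lambda>j c. (mult_mu ^^ j) (embed_lam (br u c))) (br v w)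
      - map_poly (br v) (br u w)) =
    poly_eval2 E.scal l m (poly_expand (\<lambda>k z. (mult_lam ^^ k) (at_lam_plus_mu (br z w))) (br u v))"
    unfolding E.M.poly_eval2_diff E.M.poly_eval2_poly_expand lam mu second
      E.M.poly_eval2_embed_lam E.M.poly_eval2_at_lam_plus_mu
    by (rule eval_eqI) (rule F.val_jacobi T.val_jacobi; simp add: assms br_closed)+
qed

theorem lie_conformal_algebroid: "lie_conformal_algebroid scale d G eact br \<Theta>"
proof -
  let ?kact = "\<lambda>p. eact (map_poly (\<lambda>c. scale c 1) p)"
  have alg: "alg_act ?kact = E.scal"
    by (simp add: fun_eq_iff alg_act_def scalar_act_def map_poly_pCons)
  have del: "del_act ?kact = E.del"
    by (simp add: fun_eq_iff del_act_def map_poly_pCons)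
  \<comment> \<open>Over the base field the commutation relation of \<open>dop_moduleI\<close>
    reduces to \<open>E.del\<close> commuting with scalars.\<close>
  have "dop_module (\<lambda>_. 0) G ?kact"
    by (rule dop_moduleI[where D = E.del and m = E.scal])
      (auto simp: zero_closed add_closed uminus_closed del_closed scal_closed E.del_add
        E.M.scale_right_distrib E.M.scale_left_distrib E.del_scal E.act_0 E.act_pCons
        map_poly_pCons simp flip: E.scal_conv_alg intro!: additive.intro)
  moreover have "dop_module d G eact"
    by unfold_locales
      (simp_all add: zero_closed add_closed uminus_closed act_closed E.act_add_right E.act_add_left
        E.act_mult E.act_one)
  moreover have "map_poly (\<lambda>z. \<Theta> z b) (br u v) = conf_commutator (\<Theta> u) (\<Theta> v) b"
    if "u \<in> G" "v \<in> G" for u v b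
  proof -
    have "\<Theta> 0 b = 0"
      using anchor_add[of 0 0] by simp
    then show ?thesis
      by (simp add: poly_eq_iff coeff_map_poly anchor_br that)
  qed
  ultimately show ?thesis
    by (intro lie_conformal_algebroid.intro lie_conformal_algebra.intro
        lie_conformal_algebra_axioms.intro lie_conformal_algebroid_axioms.intro
        differential_algebra_axioms; (unfold alg del)?)
      (simp_all add: br_closed br_add_left br_add_right br_scal_left br_scal_right br_del_left
        br_del_right br_jacobi carrierD anchor_add anchor_act br_act br_skew[symmetric])
qed

end

section \<open>The concrete brackets as instances of the model\<close>

lemma (in dalg_module) gauge_scale_nprod:
  "gauge_scale scale act (inverse (fact i)) (gauge_nprod scale act i (\<phi>, \<sigma>) (\<psi>, \<tau>)) =
    (\<lambda>v. coeff (conf_commutator \<phi> \<psi> v) i, \<lambda>a. coeff (conf_commutator \<sigma> \<tau> a) i)"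
proof -
  have "map_poly (scal (inverse (fact i))) (map_poly (scal (fact i)) p) = p" for p
    by (simp add: poly_eq_iff coeff_map_poly)
  moreover have "map_poly (scale (inverse (fact i))) (map_poly (scale (fact i)) p) = p" for p
    by (simp add: poly_eq_iff coeff_map_poly)
  ultimately show ?thesis
    by (simp add: gauge_scale_def gauge_nprod_def conf_nprod_def fun_eq_iff)
qed

text \<open>\<open>Abs_poly\<close> needs the sequence of pairs of maps to vanish from some index
  on. This requires degree bounds uniform in \<open>v\<close> and \<open>a\<close>; finiteness at
  each point would not suffice.\<close>

lemma (in dalg_module) coeff_gauge_br:
  assumes "fg_differential_algebra scale d" "fg_dop_module d UNIV act"
    and "X \<in> gauge scale d act" "Y \<in> gauge scale d act"
  shows "coeff (gauge_br scale act X Y) i =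
    gauge_scale scale act (inverse (fact i)) (gauge_nprod scale act i X Y)"
proof -
  obtain \<phi> \<sigma> \<psi> \<tau> where XY: "X = (\<phi>, \<sigma>)" "Y = (\<psi>, \<tau>)"
    by (cases X, cases Y)
  have "\<sigma> \<in> CDer scale d" "\<tau> \<in> CDer scale d"
    using assms(3,4) by (auto simp: XY gauge_iff)
  then obtain N where N: "\<And>a. degree (conf_commutator \<sigma> \<tau> a) \<le> N"
    using degree_commutator_bounded_CDer[OF assms(1)] by blast
  obtain K where K: "\<And>v. degree (conf_commutator \<phi> \<psi> v) \<le> K"
    using degree_commutator_bounded[OF assms[unfolded XY]] by blast
  have "coeff (gauge_br scale act X Y) =
      (\<lambda>i. gauge_scale scale act (inverse (fact i)) (gauge_nprod scale act i X Y))"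
    unfolding gauge_br_def
  proof (rule coeff_Abs_poly)
    fix j assume "max N K < j"
    then have "coeff (conf_commutator \<sigma> \<tau> a) j = 0" "coeff (conf_commutator \<phi> \<psi> v) j = 0" for a v
      using N[of a] K[of v] by (auto intro: coeff_eq_0)
    then show "gauge_scale scale act (inverse (fact j)) (gauge_nprod scale act j X Y) = 0"
      by (simp add: XY gauge_scale_nprod zero_prod_def fun_eq_iff)
  qed
  then show ?thesis by simp
qed

lemma (in differential_algebra) coeff_CDer_br:
  assumes "fg_differential_algebra scale d" "\<sigma> \<in> CDer scale d" "\<tau> \<in> CDer scale d"
  shows "coeff (CDer_br \<sigma> \<tau>) i = (\<lambda>a. coeff (conf_commutator \<sigma> \<tau> a) i)"
proof -
  interpret dalg_module scale d "regular_act d"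
    by (rule dalg_module_regular) (rule differential_algebra_axioms)
  obtain N where N: "\<And>a. degree (conf_commutator \<sigma> \<tau> a) \<le> N"
    using degree_commutator_bounded_CDer[OF assms] by blast
  have "coeff (CDer_br \<sigma> \<tau>) = (\<lambda>i a. coeff (conf_commutator \<sigma> \<tau> a) i)"
    unfolding CDer_br_def
  proof (rule coeff_Abs_poly)
    fix j assume "N < j"
    then have "coeff (conf_commutator \<sigma> \<tau> a) j = 0" for a
      using N[of a] by (auto intro: coeff_eq_0)
    then show "(\<lambda>a. coeff (conf_commutator \<sigma> \<tau> a) j) = 0"
      by (simp add: fun_eq_iff)
  qed
  then show ?thesis by simp
qed

lemma (in dalg_module) gauge_model_gauge:
  assumes "fg_differential_algebra scale d" "fg_dop_module d UNIV act"
  shows "gauge_model scale d act (gauge_act d act) (gauge scale d act) (gauge_br scale act) fst snd"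
proof unfold_locales
  fix X Y i v b
  assume XY: "X \<in> gauge scale d act" "Y \<in> gauge scale d act"
  show "fst (coeff (gauge_br scale act X Y) i) v = coeff (conf_commutator (fst X) (fst Y) v) i"
    and "snd (coeff (gauge_br scale act X Y) i) b = coeff (conf_commutator (snd X) (snd Y) b) i"
    using gauge_scale_nprod[of i "fst X" "snd X" "fst Y" "snd Y"]
    by (simp_all add: coeff_gauge_br[OF assms XY])
qed (auto simp: gauge_act_def split: prod.splits)

text \<open>This makes CDer(A) a model with both representations equal to the identity, and makes
  \<open>diagonal\<close> land in G(A,A).\<close>

lemma (in differential_algebra) gauge_regular_diagonal:
  "(\<sigma>, \<sigma>) \<in> gauge scale d (regular_act d) \<longleftrightarrow> \<sigma> \<in> CDer scale d"
proof -
  interpret R: dalg_module scale d "regular_act d"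
    by (rule dalg_module_regular) (rule differential_algebra_axioms)
  show ?thesis
    using R.CDer_iff[of \<sigma>] by (simp add: R.gauge_iff scalar_act_regular del_act_regular)
qed

lemma (in differential_algebra) gauge_model_CDer:
  assumes "fg_differential_algebra scale d"
  shows "gauge_model scale d (regular_act d) (conf_act d (regular_act d)) (CDer scale d) CDer_br
    (\<lambda>\<sigma>. \<sigma>) (\<lambda>\<sigma>. \<sigma>)"
proof -
  interpret R: dalg_module scale d "regular_act d"
    by (rule dalg_module_regular) (rule differential_algebra_axioms)
  show ?thesis
    by unfold_locales (simp_all add: gauge_regular_diagonal coeff_CDer_br[OF assms])
qed

text \<open>The target of \<open>diagonal\<close> is G(A,A), so the finiteness hypothesis has to be
  supplied for M = A; the element 1 generates.\<close>

lemma (in differential_algebra) fg_dop_module_regular: "fg_dop_module d UNIV (regular_act d)"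
proof -
  interpret R: dalg_module scale d "regular_act d"
    by (rule dalg_module_regular) (rule differential_algebra_axioms)
  have "\<exists>a. u = (\<Sum>s\<in>{1}. regular_act d (a s) s)" for u
    by (rule exI[of _ "\<lambda>_. [:u:]"]) (simp add: regular_act_def poly_expand_const)
  then show ?thesis
    unfolding fg_dop_module_def
    by (intro conjI exI[of _ "{1}"]) (simp_all add: R.dop_module_axioms)
qed

theorem proposition2p8:
  fixes scale :: "'k::field_char_0 \<Rightarrow> 'a::{comm_ring,comm_monoid_mult} \<Rightarrow> 'a"
    and d :: "'a \<Rightarrow> 'a"
    and act :: "'a poly \<Rightarrow> 'm::ab_group_add \<Rightarrow> 'm"
  assumes "fg_differential_algebra scale d"
    and "fg_dop_module d UNIV act"
  shows
    "((\<forall>X\<in>gauge scale d act. \<forall>Y\<in>gauge scale d act. \<forall>i.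
        coeff (gauge_br scale act X Y) i
          = gauge_scale scale act (inverse (fact i)) (gauge_nprod scale act i X Y))
      \<and> lie_conformal_algebroid scale d
          (gauge scale d act) (gauge_act d act) (gauge_br scale act) gauge_anchor)
    \<and> lie_conformal_algebroid_hom scale d
        (gauge scale d act) (gauge_act d act) (gauge_br scale act) gauge_anchor
        (CDer scale d) (conf_act d (regular_act d)) CDer_br (\<lambda>\<sigma>. \<sigma>)
        gauge_anchor
    \<and> (lie_conformal_algebroid_hom scale d
          (CDer scale d) (conf_act d (regular_act d)) CDer_br (\<lambda>\<sigma>. \<sigma>)
          (gauge scale d (regular_act d)) (gauge_act d (regular_act d))
            (gauge_br scale (regular_act d)) gauge_anchor
          diagonal
        \<and> (\<forall>\<sigma>\<in>CDer scale d. gauge_anchor (diagonal \<sigma>) = \<sigma>))"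
proof -
  interpret differential_algebra scale d
    using assms(1) by (simp add: fg_differential_algebra_def)
  interpret R: dalg_module scale d "regular_act d"
    by (rule dalg_module_regular) (rule differential_algebra_axioms)
  interpret M: dalg_module scale d act
    using assms(2) by (simp add: dalg_module_def differential_algebra_axioms fg_dop_module_def)
  note fg_R = assms(1) fg_dop_module_regular
  note br_M = M.coeff_gauge_br[OF assms] and br_R = R.coeff_gauge_br[OF fg_R]
  have gauge_M: "lie_conformal_algebroid scale d
      (gauge scale d act) (gauge_act d act) (gauge_br scale act) gauge_anchor"
    using gauge_model.lie_conformal_algebroid[OF M.gauge_model_gauge[OF assms]]
    by (simp add: gauge_anchor_def)
  have gauge_R: "lie_conformal_algebroid scale d (gauge scale d (regular_act d))
      (gauge_act d (regular_act d)) (gauge_br scale (regular_act d)) gauge_anchor"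
    using gauge_model.lie_conformal_algebroid[OF R.gauge_model_gauge[OF fg_R]]
    by (simp add: gauge_anchor_def)
  have CDer: "lie_conformal_algebroid scale d
      (CDer scale d) (conf_act d (regular_act d)) CDer_br (\<lambda>\<sigma>. \<sigma>)"
    by (rule gauge_model.lie_conformal_algebroid[OF gauge_model_CDer[OF assms(1)]])
  have anchor: "gauge_anchor X \<in> CDer scale d" if "X \<in> gauge scale d act" for X
    using that by (auto simp: gauge_anchor_def gauge_def)
  have br_anchor: "CDer_br (gauge_anchor X) (gauge_anchor Y) = map_poly gauge_anchor (gauge_br scale act X Y)"
    if "X \<in> gauge scale d act" "Y \<in> gauge scale d act" for X Y
    using M.gauge_scale_nprod[of _ "fst X" "snd X" "fst Y" "snd Y"] anchor[OF that(1)] anchor[OF that(2)]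
    by (simp add: poly_eq_iff coeff_map_poly gauge_anchor_def br_M[OF that] coeff_CDer_br[OF assms(1)])
  have br_diagonal: "gauge_br scale (regular_act d) (diagonal \<sigma>) (diagonal \<tau>) = map_poly diagonal (CDer_br \<sigma> \<tau>)"
    if "\<sigma> \<in> CDer scale d" "\<tau> \<in> CDer scale d" for \<sigma> \<tau>
    using that
    by (simp add: poly_eq_iff coeff_map_poly diagonal_def br_R gauge_regular_diagonal
        R.gauge_scale_nprod coeff_CDer_br[OF assms(1)] zero_prod_def)
  have "lie_conformal_algebroid_hom scale d
        (gauge scale d act) (gauge_act d act) (gauge_br scale act) gauge_anchor
        (CDer scale d) (conf_act d (regular_act d)) CDer_br (\<lambda>\<sigma>. \<sigma>) gauge_anchor"
    by (intro lie_conformal_algebroid_hom.intro lie_conformal_algebroid_hom_axioms.intro gauge_M CDer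
        anchor br_anchor)
      (auto simp: gauge_anchor_def gauge_act_def)
  moreover have "lie_conformal_algebroid_hom scale d
          (CDer scale d) (conf_act d (regular_act d)) CDer_br (\<lambda>\<sigma>. \<sigma>)
          (gauge scale d (regular_act d)) (gauge_act d (regular_act d))
            (gauge_br scale (regular_act d)) gauge_anchor diagonal"
    by (intro lie_conformal_algebroid_hom.intro lie_conformal_algebroid_hom_axioms.intro CDer gauge_R
        br_diagonal)
      (auto simp: diagonal_def gauge_anchor_def gauge_act_def gauge_regular_diagonal)
  ultimately show ?thesis
    using br_M gauge_M by (simp add: diagonal_def gauge_anchor_def)
qed

end
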